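(* Fix $k\in\mathbb{Z}_{\geq 1}$ and a set of patterns $B\subseteq\mathcal S$. Then the feasible region $P^{\mathrm{Av}(B)}_k$ is a closed subset of $[0,1]^{\mathcal S_k}$ and $$P^{\mathrm{Av}(B)}_k\subseteq P(\mathcal{O}v(k,\mathrm{Av}(B)))\subseteq P_k .$$ Moreover, if $\mathrm{Av}(B)$ is closed under the operation $\oplus$ or closed under the operation $\ominus$, then $P^{\mathrm{Av}(B)}_k$ is convex and $\dim(P^{\mathrm{Av}(B)}_k)\leq |\mathrm{Av}_k(B)|-|\mathrm{Av}_{k-1}(B)|$. In particular, for every single pattern $\tau\in\mathcal S$, $P^{\mathrm{Av}(\tau)}_k$ is convex.
   Context: For $n\ge1$, $\mathcal S_n$ is the set of permutations of $[n]=\{1,\dots,n\}$ in one-line notation, $\mathcal S=\bigcup_{n\ge1}\mathcal S_n$; by convention $\mathcal S_0$ and $\mathrm{Av}_0(B)$ consist of the empty permutation. For distinct reals $x_1,\dots,x_m$, $\mathrm{std}(x_1,\dots,x_m)$ is the unique $\pi\in\mathcal S_m$ with $\pi(i)<\pi(j)\iff x_i<x_j$. For $\sigma\in\mathcal S_n$ and $I=\{i_1<\dots<i_m\}\subseteq[n]$, $\mathrm{pat}_I(\sigma)=\mathrm{std}(\sigma(i_1),\dots,\sigma(i_m))$. A permutation $\sigma$ contains $\pi$ if $\mathrm{pat}_I(\sigma)=\pi$ for some $I$, and avoids $\pi$ otherwise. For $B\subseteq\mathcal S$, $\mathrm{Av}_n(B)$ is the set of permutations of size $n$ avoiding every element of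 $B$, and $\mathrm{Av}(B)=\bigcup_{n\ge1}\mathrm{Av}_n(B)$; $\mathrm{Av}(\tau)=\mathrm{Av}(\{\tau\})$. For $\pi\in\mathcal S_k$, $\sigma\in\mathcal S_n$, $\mathrm{c\text{-}occ}(\pi,\sigma)$ is the number of intervals $I=\{i,i+1,\dots,i+k-1\}\subseteq[n]$ with $\mathrm{pat}_I(\sigma)=\pi$, and $\widetilde{\mathrm{c\text{-}occ}}(\pi,\sigma)=\mathrm{c\text{-}occ}(\pi,\sigma)/n$. Feasible region: $P^{\mathrm{Av}(B)}_k$ is the set of $\vec v\in[0,1]^{\mathcal S_k}$ for which there is a sequence $(\sigma^m)_{m\ge1}$ in $\mathrm{Av}(B)$ with $|\sigma^m|\to\infty$ and $\widetilde{\mathrm{c\text{-}occ}}(\pi,\sigma^m)\to\vec v_\pi$ for all $\pi\in\mathcal S_k$; $P_k$ denotes this set when $B=\emptyset$ (all permutations allowed). Graphs are directed multigraphs (loops and parallel edges allowed); $\mathrm{st}(e),\mathrm{ar}(e)$ denote start and arrival vertex of edge $e$. A walk is a sequence of edges $(e_1,\dots,e_m)$ with $\mathrm{ar}(e_i)=\mathrm{st}(e_{i+1})$; it is a cycle if $\mathrm{st}(e_1)=\mathrm{ar}(e_m)$, and a simple cycle if moreover its edges are distinct and the vertices $\mathrm{st}(e_1),\dots,\mathrm{st}(e_m)$ are distinct. For a nonempty cycle $\mathcal C$ of $G=(V,E)$, $\vec e_{\mathcal C}\in\mathbb R^E$ has $e$-coordinate equal to (number of occurrences of $e$ in $\mathcal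 C$)$/|\mathcal C|$. The cycle polytope is $P(G)=\mathrm{conv}\{\vec e_{\mathcal C}:\mathcal C\text{ a simple cycle of }G\}$. Overlap graph: $\mathcal{O}v(k,\mathrm{Av}(B))$ has vertex set $\mathrm{Av}_{k-1}(B)$ and, for each $\pi\in\mathrm{Av}_k(B)$, one edge labelled $\pi$ from $\mathrm{pat}_{\{1,\dots,k-1\}}(\pi)$ to $\mathrm{pat}_{\{2,\dots,k\}}(\pi)$. Since its edges are in bijection with $\mathrm{Av}_k(B)$, its cycle polytope lies in $\mathbb R^{\mathrm{Av}_k(B)}$, which is identified with the subspace of $\mathbb R^{\mathcal S_k}$ of vectors vanishing outside $\mathrm{Av}_k(B)$. Direct sum: for $\tau\in\mathcal S_m,\sigma\in\mathcal S_n$, $\tau\oplus\sigma=\tau(1)\cdots\tau(m)(\sigma(1)+m)\cdots(\sigma(n)+m)$; skew sum $\tau\ominus\sigma=(\tau(1)+n)\cdots(\tau(m)+n)\sigma(1)\cdots\sigma(n)$. $\mathrm{Av}(B)$ is closed under $\oplus$ if $\tau,\sigma\in\mathrm{Av}(B)$ implies $\tau\oplus\sigma\in\mathrm{Av}(B)$ (similarly for $\ominus$). The dimension of a convex set is the dimension of its affine hull. *)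

theory Defs
  imports "HOL-Analysis.Analysis" "HOL-Library.Function_Algebras"
begin

instantiation "fun" :: (type, real_vector) real_vector
begin
definition scaleR_fun_def: "scaleR r f = (\<lambda>x. scaleR r (f x))"
instance
  by standard (simp_all add: scaleR_fun_def plus_fun_def fun_eq_iff scaleR_add_right scaleR_add_left)
end

definition affine_dim :: "('a::real_vector) set \<Rightarrow> int" where
  "affine_dim S = (if S = {} then -1
     else int (dim {x - y | x y. x \<in> affine hull S \<and> y \<in> affine hull S}))"

definition perms :: "nat \<Rightarrow> nat list set" where
  "perms n = {p. length p = n \<and> distinct p \<and> set p = {1..n}}"

definition all_perms :: "nat list set" where
  "all_perms = (\<Union>n\<in>{1..}. perms n)"

definition std :: "('a::linorder) list \<Rightarrow> nat list" where
  "std xs = map (\<lambda>x. card {y \<in> set xs. y \<le> x}) xs"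

definition pat :: "nat set \<Rightarrow> nat list \<Rightarrow> nat list" where
  "pat I \<sigma> = std (map (\<lambda>i. \<sigma> ! (i - 1)) (sorted_list_of_set I))"

definition contains :: "nat list \<Rightarrow> nat list \<Rightarrow> bool" where
  "contains \<sigma> \<pi> \<longleftrightarrow> (\<exists>I \<subseteq> {1..length \<sigma>}. pat I \<sigma> = \<pi>)"

definition Av_n :: "nat \<Rightarrow> nat list set \<Rightarrow> nat list set" where
  "Av_n n B = {\<sigma> \<in> perms n. \<forall>\<beta>\<in>B. \<not> contains \<sigma> \<beta>}"

definition Av :: "nat list set \<Rightarrow> nat list set" where
  "Av B = (\<Union>n\<in>{1..}. Av_n n B)"

definition cocc :: "nat list \<Rightarrow> nat list \<Rightarrow> nat" where
  "cocc \<pi> \<sigma> = card {i. 1 \<le> i \<and> i + length \<pi> - 1 \<le> length \<sigma>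
                       \<and> pat {i..i + length \<pi> - 1} \<sigma> = \<pi>}"

definition cocc_prop :: "nat list \<Rightarrow> nat list \<Rightarrow> real" where
  "cocc_prop \<pi> \<sigma> = real (cocc \<pi> \<sigma>) / real (length \<sigma>)"

text \<open>[0,1]^{S_k}, identified with functions vanishing outside S_k.\<close>
definition cube :: "nat \<Rightarrow> (nat list \<Rightarrow> real) set" where
  "cube k = {v. (\<forall>\<pi>\<in>perms k. 0 \<le> v \<pi> \<and> v \<pi> \<le> 1) \<and> (\<forall>\<pi>. \<pi> \<notin> perms k \<longrightarrow> v \<pi> = 0)}"

definition feasible :: "nat \<Rightarrow> nat list set \<Rightarrow> (nat list \<Rightarrow> real) set" where
  "feasible k B = {v \<in> cube k. \<exists>\<sigma> :: nat \<Rightarrow> nat list.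
      (\<forall>m. \<sigma> m \<in> Av B) \<and> filterlim (\<lambda>m. length (\<sigma> m)) at_top sequentially \<and>
      (\<forall>\<pi>\<in>perms k. (\<lambda>m. cocc_prop \<pi> (\<sigma> m)) \<longlonglongrightarrow> v \<pi>)}"

text \<open>A multigraph is given by its edge set E and start/arrival maps st, ar.
  Walks are lists of edges.\<close>
definition walk :: "'e set \<Rightarrow> ('e \<Rightarrow> 'v) \<Rightarrow> ('e \<Rightarrow> 'v) \<Rightarrow> 'e list \<Rightarrow> bool" where
  "walk E st ar es \<longleftrightarrow> set es \<subseteq> E \<and> (\<forall>i. Suc i < length es \<longrightarrow> ar (es ! i) = st (es ! Suc i))"

definition cycle :: "'e set \<Rightarrow> ('e \<Rightarrow> 'v) \<Rightarrow> ('e \<Rightarrow> 'v) \<Rightarrow> 'e list \<Rightarrow> bool" where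
  "cycle E st ar es \<longleftrightarrow> es \<noteq> [] \<and> walk E st ar es \<and> st (hd es) = ar (last es)"

definition simple_cycle :: "'e set \<Rightarrow> ('e \<Rightarrow> 'v) \<Rightarrow> ('e \<Rightarrow> 'v) \<Rightarrow> 'e list \<Rightarrow> bool" where
  "simple_cycle E st ar es \<longleftrightarrow> cycle E st ar es \<and> distinct es \<and> distinct (map st es)"

definition cycle_vec :: "'e list \<Rightarrow> ('e \<Rightarrow> real)" where
  "cycle_vec es = (\<lambda>e. real (count_list es e) / real (length es))"

definition cycle_polytope :: "'e set \<Rightarrow> ('e \<Rightarrow> 'v) \<Rightarrow> ('e \<Rightarrow> 'v) \<Rightarrow> ('e \<Rightarrow> real) set" where
  "cycle_polytope E st ar = convex hull {cycle_vec C | C. simple_cycle E st ar C}"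

text \<open>Overlap graph Ov(k, Av(B)): vertices Av_{k-1}(B), one edge pi for each pi in Av_k(B),
  from pat_{1..k-1}(pi) to pat_{2..k}(pi).\<close>
definition overlap_polytope :: "nat \<Rightarrow> nat list set \<Rightarrow> (nat list \<Rightarrow> real) set" where
  "overlap_polytope k B = cycle_polytope (Av_n k B) (\<lambda>\<pi>. pat {1..k-1} \<pi>) (\<lambda>\<pi>. pat {2..k} \<pi>)"

definition dsum :: "nat list \<Rightarrow> nat list \<Rightarrow> nat list" where
  "dsum \<tau> \<sigma> = \<tau> @ map (\<lambda>x. x + length \<tau>) \<sigma>"

definition ssum :: "nat list \<Rightarrow> nat list \<Rightarrow> nat list" where
  "ssum \<tau> \<sigma> = map (\<lambda>x. x + length \<sigma>) \<tau> @ \<sigma>"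

definition closed_dsum :: "nat list set \<Rightarrow> bool" where
  "closed_dsum B \<longleftrightarrow> (\<forall>\<tau>\<in>Av B. \<forall>\<sigma>\<in>Av B. dsum \<tau> \<sigma> \<in> Av B)"

definition closed_ssum :: "nat list set \<Rightarrow> bool" where
  "closed_ssum B \<longleftrightarrow> (\<forall>\<tau>\<in>Av B. \<forall>\<sigma>\<in>Av B. ssum \<tau> \<sigma> \<in> Av B)"

end

theory Submission
  imports Defs "HOL-Library.Sublist"
begin

text \<open>
  Counting the consecutive patterns of a permutation by their first (or last) k - 1 entries counts
  its windows of length k - 1, up to one window at either end. In the limit a feasible vector is
  therefore a nonnegative circulation of total mass 1 on the overlap graph, and subtracting simple
  cycles from its support writes it as a convex combination of simple cycles. Conversely, every walk
  in the full overlap graph is the sequence of windows of some sequence of reals, built by appending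
  one value at a time; repeating a simple cycle gives its vector in the limit.

  A direct or skew sum adds occurrence counts up to at most k occurrences across the seam. Sums of
  many copies of two permutations thus realise every convex combination. Closure under a sum also
  makes the overlap graph strongly connected. Then every vertex can choose an outgoing edge so that
  all choices lead to one root; a circulation of total mass 0 supported on the chosen edges
  vanishes, so the circulations of total mass 0 have dimension at most |E| - |V|.

  A pattern that occurs across the seam of a direct sum has its first entry below its last one, for
  a skew sum it is above; so in a class avoiding one pattern one of the two sums never leaves the
  class.
\<close>

section \<open>Standardization and consecutive windows\<close>

definition rank_in :: "'a::linorder set \<Rightarrow> 'a \<Rightarrow> nat" where
  "rank_in A x = card {y \<in> A. y \<le> x}"

lemma strict_mono_on_rank_in:
  assumes "finite A"
  shows "strict_mono_on A (rank_in A)"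
proof (rule strict_mono_onI)
  fix r s assume "r \<in> A" "s \<in> A" "r < s"
  then have "{y \<in> A. y \<le> r} \<subset> {y \<in> A. y \<le> s}" by force
  then show "rank_in A r < rank_in A s"
    unfolding rank_in_def using assms by (intro psubset_card_mono) auto
qed

lemma std_eq_map_rank_in: "std xs = map (rank_in (set xs)) xs"
  by (simp add: std_def rank_in_def)

lemma length_std [simp]: "length (std xs) = length xs"
  by (simp add: std_def)

lemma std_map:
  fixes f :: "'a::linorder \<Rightarrow> 'b::linorder"
  assumes "strict_mono_on (set xs) f"
  shows "std (map f xs) = std xs"
proof -
  have "rank_in (f ` set xs) (f x) = rank_in (set xs) x" if "x \<in> set xs" for x
  proof -
    have "{y \<in> f ` set xs. y \<le> f x} = f ` {y \<in> set xs. y \<le> x}"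
      using that strict_mono_on_less_eq[OF assms] by auto
    moreover have "inj_on f {y \<in> set xs. y \<le> x}"
      using strict_mono_on_imp_inj_on[OF assms] by (rule inj_on_subset) auto
    ultimately show ?thesis
      by (simp add: rank_in_def card_image)
  qed
  then show ?thesis
    by (simp add: std_eq_map_rank_in)
qed

lemma std_map_add [simp]: "std (map (\<lambda>x. x + a) xs) = std (xs :: nat list)"
  by (intro std_map) (simp add: strict_mono_on_def)

lemma std_map_rank_in:
  assumes "set ys \<subseteq> set xs"
  shows "std (map (rank_in (set xs)) ys) = std ys"
  using monotone_on_subset[OF strict_mono_on_rank_in assms] by (intro std_map) simp

lemma std_nth_le_iff:
  assumes "i < length xs" "j < length xs"
  shows "std xs ! i \<le> std xs ! j \<longleftrightarrow> xs ! i \<le> xs ! j"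
  using strict_mono_on_less_eq[OF strict_mono_on_rank_in, of "set xs" "xs ! i" "xs ! j"] assms
  by (simp add: std_eq_map_rank_in)

lemma std_nth_less_iff:
  assumes "i < length xs" "j < length xs"
  shows "std xs ! i < std xs ! j \<longleftrightarrow> xs ! i < xs ! j"
  using std_nth_le_iff[OF assms(2,1)] by (simp add: linorder_not_le[symmetric])

lemma std_nth:
  assumes "distinct xs" "i < length xs"
  shows "std xs ! i = card {j. j < length xs \<and> xs ! j \<le> xs ! i}"
proof -
  have "{y \<in> set xs. y \<le> xs ! i} = (!) xs ` {j. j < length xs \<and> xs ! j \<le> xs ! i}"
    by (auto simp: in_set_conv_nth)
  moreover have "inj_on ((!) xs) {j. j < length xs \<and> xs ! j \<le> xs ! i}"
    using assms(1) by (auto simp: inj_on_def nth_eq_iff_index_eq)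
  ultimately show ?thesis
    using assms(2) by (simp add: std_def card_image)
qed

lemma std_eqI:
  fixes xs :: "'a::linorder list" and ys :: "'b::linorder list"
  assumes "distinct xs" "distinct ys" "length xs = length ys"
    and "\<And>i j. i < length xs \<Longrightarrow> j < length xs \<Longrightarrow> xs ! i \<le> xs ! j \<longleftrightarrow> ys ! i \<le> ys ! j"
  shows "std xs = std ys"
proof (rule nth_equalityI)
  fix i assume "i < length (std xs)"
  moreover from this
  have "{j. j < length xs \<and> xs ! j \<le> xs ! i} = {j. j < length ys \<and> ys ! j \<le> ys ! i}"
    using assms by auto
  ultimately show "std xs ! i = std ys ! i"
    using assms by (simp add: std_nth)
qed (simp add: assms)

lemma perms_iff: "p \<in> perms n \<longleftrightarrow> length p = n \<and> set p = {1..n}"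
  by (auto simp: perms_def intro: card_distinct)

lemma finite_perms: "finite (perms n)"
proof (rule finite_subset)
  show "perms n \<subseteq> {xs. set xs \<subseteq> {1..n} \<and> length xs = n}" by (auto simp: perms_iff)
qed (simp add: finite_lists_length_eq)

lemma std_perms:
  assumes "p \<in> perms n"
  shows "std p = p"
proof -
  have "{y \<in> set p. y \<le> x} = {1..x}" if "x \<in> set p" for x
    using assms that by (auto simp: perms_iff)
  then show ?thesis by (simp add: std_def map_idI)
qed

lemma std_in_perms:
  fixes xs :: "'a::linorder list"
  assumes "distinct xs"
  shows "std xs \<in> perms (length xs)"
proof -
  have "distinct (std xs)"
    unfolding std_eq_map_rank_in distinct_map
    using assms strict_mono_on_imp_inj_on[OF strict_mono_on_rank_in] by blast
  then have "card (set (std xs)) = card {1..length xs}"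
    by (simp add: distinct_card)
  moreover have "rank_in (set xs) x \<in> {1..length xs}" if "x \<in> set xs" for x
  proof -
    have "rank_in (set xs) x \<le> card (set xs)"
      unfolding rank_in_def by (intro card_mono) auto
    moreover have "rank_in (set xs) x > 0"
      using that by (auto simp: rank_in_def card_gt_0_iff)
    ultimately show ?thesis
      using card_length[of xs] by simp
  qed
  then have "set (std xs) \<subseteq> {1..length xs}"
    by (auto simp: std_eq_map_rank_in)
  ultimately show ?thesis
    by (simp add: perms_iff card_subset_eq)
qed

definition window :: "nat \<Rightarrow> nat \<Rightarrow> 'a::linorder list \<Rightarrow> nat list" where
  "window k i xs = std (take k (drop i xs))"

lemma window_std: "window k i (std xs) = window k i xs"
proof -
  have "set (take k (drop i xs)) \<subseteq> set xs"
    by (meson in_set_takeD in_set_dropD subsetI)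
  from std_map_rank_in[OF this] show ?thesis
    unfolding window_def by (simp add: std_eq_map_rank_in[of xs] take_map drop_map)
qed

lemma window_window:
  assumes "i + m \<le> n"
  shows "window m i (window n j xs) = window m (i + j) xs"
proof -
  have "window m i (window n j xs) = window m i (take n (drop j xs))"
    using window_std[of m i "take n (drop j xs)"] by (simp add: window_def)
  also have "\<dots> = window m (i + j) xs"
    using assms by (simp add: window_def drop_take add.commute)
  finally show ?thesis .
qed

lemma window_perms: "p \<in> perms n \<Longrightarrow> window n 0 p = p"
  using std_perms[of p n] by (simp add: window_def perms_def)

lemma window_append: "i + k \<le> length xs \<Longrightarrow> window k i (xs @ ys) = window k i xs"
  by (simp add: window_def)

lemma pat_atLeastAtMost_eq_window:
  assumes "i + m \<le> length \<sigma>"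
  shows "pat {Suc i..i + m} \<sigma> = window m i \<sigma>"
proof -
  have "map (\<lambda>j. \<sigma> ! (j - 1)) [Suc i..<Suc (i + m)] = take m (drop i \<sigma>)"
    using assms by (intro nth_equalityI) (auto simp del: upt_Suc)
  then show ?thesis
    by (simp add: pat_def window_def del: upt_Suc flip: atLeastLessThanSuc_atLeastAtMost)
qed

definition window_positions :: "nat list \<Rightarrow> nat list \<Rightarrow> nat set" where
  "window_positions \<pi> \<sigma> = {i. i + length \<pi> \<le> length \<sigma> \<and> window (length \<pi>) i \<sigma> = \<pi>}"

lemma finite_window_positions [simp]: "finite (window_positions \<pi> \<sigma>)"
  by (rule finite_subset[of _ "{..length \<sigma>}"]) (auto simp: window_positions_def)

lemma cocc_eq_card_window_positions:
  assumes "\<pi> \<noteq> []"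
  shows "cocc \<pi> \<sigma> = card (window_positions \<pi> \<sigma>)"
proof -
  let ?occ = "\<lambda>i. 1 \<le> i \<and> i + length \<pi> - 1 \<le> length \<sigma> \<and> pat {i..i + length \<pi> - 1} \<sigma> = \<pi>"
  have "?occ (Suc i) \<longleftrightarrow> i \<in> window_positions \<pi> \<sigma>" for i
    using pat_atLeastAtMost_eq_window[of i "length \<pi>" \<sigma>] by (auto simp: window_positions_def)
  moreover have "\<not> ?occ 0"
    by simp
  ultimately have "?occ i \<longleftrightarrow> i \<in> Suc ` window_positions \<pi> \<sigma>" for i
    by (cases i) (auto simp: image_iff)
  then have "{i. ?occ i} = Suc ` window_positions \<pi> \<sigma>"
    by blast
  then show ?thesis
    unfolding cocc_def by (simp add: card_image)
qed

section \<open>Pattern containment\<close>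

lemma pat_eq_std_nths:
  assumes "I \<subseteq> {1..length \<sigma>}"
  shows "pat I \<sigma> = std (nths \<sigma> {i. Suc i \<in> I})"
proof -
  have "finite I"
    using assms finite_subset by blast
  then have "sorted_list_of_set I = filter (\<lambda>i. i \<in> I) [1..<Suc (length \<sigma>)]"
    using assms by (intro sorted_distinct_set_unique)
      (auto simp: sorted_filter[where f = id, simplified] simp del: upt_Suc)
  also have "\<dots> = map Suc (filter (\<lambda>i. Suc i \<in> I) [0..<length \<sigma>])"
    unfolding One_nat_def map_Suc_upt[symmetric] by (simp add: filter_map comp_def)
  finally have "map (\<lambda>i. \<sigma> ! (i - 1)) (sorted_list_of_set I)
      = map ((!) \<sigma>) (filter (\<lambda>i. Suc i \<in> I) [0..<length \<sigma>])"
    by simp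
  also have "\<dots> = nths \<sigma> {i. Suc i \<in> I}"
  proof -
    have "zip \<sigma> [0..<length \<sigma>] = map (\<lambda>i. (\<sigma> ! i, i)) [0..<length \<sigma>]"
      by (intro nth_equalityI) auto
    then show ?thesis by (simp add: nths_def filter_map comp_def)
  qed
  finally show ?thesis by (simp add: pat_def)
qed

lemma contains_iff_subseq: "contains \<sigma> \<pi> \<longleftrightarrow> (\<exists>ys. subseq ys \<sigma> \<and> std ys = \<pi>)"
proof
  assume "contains \<sigma> \<pi>"
  then show "\<exists>ys. subseq ys \<sigma> \<and> std ys = \<pi>"
    unfolding contains_def using pat_eq_std_nths by (metis subseq_conv_nths)
next
  assume "\<exists>ys. subseq ys \<sigma> \<and> std ys = \<pi>"
  then obtain N where N: "std (nths \<sigma> N) = \<pi>"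
    by (auto simp: subseq_conv_nths)
  let ?I = "Suc ` (N \<inter> {..<length \<sigma>})"
  have "nths \<sigma> {i. Suc i \<in> ?I} = nths \<sigma> N"
    unfolding nths_def by (intro arg_cong[where f = "map fst"] filter_cong) (auto simp: set_zip)
  then have "pat ?I \<sigma> = \<pi>"
    using N by (subst pat_eq_std_nths) auto
  then show "contains \<sigma> \<pi>"
    unfolding contains_def by (intro exI[of _ ?I]) auto
qed

lemma contains_if_std_subseq_contains:
  assumes "subseq zs \<sigma>" "contains (std zs) \<pi>"
  shows "contains \<sigma> \<pi>"
proof -
  obtain ys where ys: "subseq ys (map (rank_in (set zs)) zs)" "std ys = \<pi>"
    using assms(2) unfolding contains_iff_subseq std_eq_map_rank_in[of zs] by blast
  then obtain N where "ys = map (rank_in (set zs)) (nths zs N)"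
    by (auto simp: subseq_conv_nths nths_map)
  then have "std (nths zs N) = \<pi>"
    using ys(2) std_map_rank_in[OF set_nths_subset] by metis
  moreover have "subseq (nths zs N) \<sigma>"
    using assms(1) by (meson subseq_conv_nths subseq_order.trans)
  ultimately show ?thesis
    unfolding contains_iff_subseq by blast
qed

lemma Av_n_subset_perms: "Av_n n B \<subseteq> perms n"
  by (auto simp: Av_n_def)

lemma finite_Av_n: "finite (Av_n n B)"
  using Av_n_subset_perms finite_perms by (rule finite_subset)

lemma length_Av_n: "\<sigma> \<in> Av_n n B \<Longrightarrow> length \<sigma> = n"
  by (simp add: Av_n_def perms_def)

lemma Av_n_zero_subset: "Av_n 0 B \<subseteq> {[]}"
  by (auto dest: length_Av_n)

lemma Av_iff: "\<sigma> \<in> Av B \<longleftrightarrow> \<sigma> \<noteq> [] \<and> \<sigma> \<in> Av_n (length \<sigma>) B"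
  unfolding Av_def using length_Av_n by (fastforce simp: Suc_le_eq)

lemma Av_singleton_iff: "\<sigma> \<in> Av {\<tau>} \<longleftrightarrow> \<sigma> \<noteq> [] \<and> \<sigma> \<in> perms (length \<sigma>) \<and> \<not> contains \<sigma> \<tau>"
  by (simp add: Av_iff Av_n_def)

lemma Av_empty_iff: "\<sigma> \<in> Av {} \<longleftrightarrow> \<sigma> \<noteq> [] \<and> \<sigma> \<in> perms (length \<sigma>)"
  by (simp add: Av_iff Av_n_def)

lemma window_in_Av_n:
  assumes "\<sigma> \<in> Av_n n B" "i + k \<le> n"
  shows "window k i \<sigma> \<in> Av_n k B"
proof -
  have "subseq (take k (drop i \<sigma>)) \<sigma>"
    by (metis prefix_imp_subseq subseq_order.trans suffix_drop suffix_imp_subseq take_is_prefix)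
  then have "\<not> contains (window k i \<sigma>) \<beta>" if "\<beta> \<in> B" for \<beta>
    using assms(1) that contains_if_std_subseq_contains unfolding Av_n_def window_def by blast
  moreover have "distinct \<sigma>" "length \<sigma> = n"
    using assms(1) by (auto simp: Av_n_def perms_def)
  then have "window k i \<sigma> \<in> perms k"
    unfolding window_def using std_in_perms[of "take k (drop i \<sigma>)"] assms(2)
    by (simp add: min_absorb2)
  ultimately show ?thesis
    by (simp add: Av_n_def)
qed

section \<open>The overlap graph\<close>

abbreviation overlap_start :: "nat \<Rightarrow> nat list \<Rightarrow> nat list" where
  "overlap_start k \<pi> \<equiv> pat {1..k - 1} \<pi>"

abbreviation overlap_end :: "nat \<Rightarrow> nat list \<Rightarrow> nat list" where
  "overlap_end k \<pi> \<equiv> pat {2..k} \<pi>"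

lemma overlap_ends:
  assumes "length \<pi> = k" "k \<ge> 1"
  shows "overlap_start k \<pi> = window (k - 1) 0 \<pi>" "overlap_end k \<pi> = window (k - 1) 1 \<pi>"
  using pat_atLeastAtMost_eq_window[of 0 "k - 1" \<pi>] pat_atLeastAtMost_eq_window[of 1 "k - 1" \<pi>]
    assms
  by (simp_all add: numeral_2_eq_2)

lemma overlap_ends_window:
  assumes "i + k \<le> length xs" "k \<ge> 1"
  shows "overlap_start k (window k i xs) = window (k - 1) i xs"
    and "overlap_end k (window k i xs) = window (k - 1) (Suc i) xs"
proof -
  have "length (window k i xs) = k"
    using assms(1) by (simp add: window_def)
  note overlap_ends[OF this assms(2)]
  with assms(2) show "overlap_start k (window k i xs) = window (k - 1) i xs"
    and "overlap_end k (window k i xs) = window (k - 1) (Suc i) xs"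
    by (simp_all add: window_window)
qed

lemma overlap_end_in_Av_n:
  assumes "\<pi> \<in> Av_n k B" "k \<ge> 1"
  shows "overlap_end k \<pi> \<in> Av_n (k - 1) B"
  using overlap_ends(2)[OF length_Av_n[OF assms(1)] assms(2)] assms by (auto intro: window_in_Av_n)

section \<open>Walks and circulations on multigraphs\<close>

lemma walk_iff_successively:
  "walk E st ar es \<longleftrightarrow> set es \<subseteq> E \<and> successively (\<lambda>e e'. ar e = st e') es"
  by (simp add: walk_def successively_conv_nth)

lemma walk_append:
  "walk E st ar (es @ fs) \<longleftrightarrow> walk E st ar es \<and> walk E st ar fs
     \<and> (es = [] \<or> fs = [] \<or> ar (last es) = st (hd fs))"
  by (auto simp: walk_iff_successively successively_append_iff)

lemma walk_concat_replicate:
  assumes "cycle E st ar C"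
  shows "walk E st ar (concat (replicate m C))"
proof (induction m)
  case (Suc m)
  have "concat (replicate m C) = [] \<or> hd (concat (replicate m C)) = hd C"
    using assms by (cases m) (auto simp: cycle_def)
  then show ?case
    using assms Suc.IH by (auto simp: walk_append cycle_def)
qed (simp add: walk_def)

lemma count_list_concat_replicate: "count_list (concat (replicate m xs)) x = m * count_list xs x"
  by (induction m) auto

lemma simple_cycle_mono: "simple_cycle E st ar C \<Longrightarrow> E \<subseteq> F \<Longrightarrow> simple_cycle F st ar C"
  by (auto simp: simple_cycle_def cycle_def walk_def)

lemma map_ar_cycle:
  assumes "cycle E st ar C"
  shows "map ar C = rotate1 (map st C)"
proof -
  have "map ar (butlast es) = map st (tl es)" if "successively (\<lambda>e e'. ar e = st e') es" for es
    using that by (induction es rule: induct_list012) auto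
  then have "map ar (butlast C) = map st (tl C)"
    using assms by (simp add: cycle_def walk_iff_successively)
  moreover have "C \<noteq> []" "ar (last C) = st (hd C)"
    using assms by (simp_all add: cycle_def)
  ultimately have "map ar (butlast C @ [last C]) = rotate1 (map st C)"
    by (cases C) simp_all
  then show ?thesis
    using \<open>C \<noteq> []\<close> by simp
qed

lemma scaleR_fun_apply [simp]: "(c *\<^sub>R f) x = c *\<^sub>R f x"
  by (simp add: scaleR_fun_def)

definition circulation :: "'e set \<Rightarrow> ('e \<Rightarrow> 'v) \<Rightarrow> ('e \<Rightarrow> 'v) \<Rightarrow> ('e \<Rightarrow> real) \<Rightarrow> bool" where
  "circulation E st ar f \<longleftrightarrow> (\<forall>e. e \<notin> E \<longrightarrow> f e = 0)
     \<and> (\<forall>x. (\<Sum>e | e \<in> E \<and> st e = x. f e) = (\<Sum>e | e \<in> E \<and> ar e = x. f e))"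

lemma subspace_circulations: "subspace {f. circulation E st ar f}"
  by (auto simp: subspace_def circulation_def sum.distrib simp flip: sum_distrib_left)

lemma linear_sum_fun: "linear (\<lambda>f. sum f E :: real)"
  by (intro linearI) (simp_all add: sum.distrib sum_distrib_left)

lemma sum_count_list_fiber:
  assumes "finite E" "set C \<subseteq> E"
  shows "(\<Sum>e | e \<in> E \<and> h e = x. count_list C e) = count_list (map h C) x"
  using assms(2)
proof (induction C)
  case (Cons c C)
  have "(\<Sum>e | e \<in> E \<and> h e = x. count_list (c # C) e)
    = (\<Sum>e | e \<in> E \<and> h e = x. count_list C e) + (\<Sum>e | e \<in> E \<and> h e = x. if c = e then 1 else 0)"
    by (simp flip: sum.distrib) (intro sum.cong, auto)
  then show ?case
    using Cons assms(1) by (auto simp: sum.delta')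
qed simp

lemma circulation_cycle_vec:
  assumes "finite E" "cycle E st ar C"
  shows "circulation E st ar (cycle_vec C)"
proof -
  have "set C \<subseteq> E"
    using assms(2) by (simp add: cycle_def walk_def)
  then have "(\<Sum>e | e \<in> E \<and> h e = x. cycle_vec C e) = count_list (map h C) x / length C"
    for h :: "'a \<Rightarrow> 'b" and x
    using sum_count_list_fiber[OF assms(1), of C h x]
    by (simp add: cycle_vec_def flip: sum_divide_distrib of_nat_sum)
  moreover have "count_list (rotate1 xs) x = count_list xs x" for xs :: "'b list" and x
    by (cases xs) auto
  moreover have "cycle_vec C e = 0" if "e \<notin> E" for e
    using that \<open>set C \<subseteq> E\<close> by (auto simp: cycle_vec_def count_list_0_iff)
  ultimately show ?thesis
    using map_ar_cycle[OF assms(2)] by (simp add: circulation_def)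
qed

lemma cycle_vec_distinct: "distinct C \<Longrightarrow> cycle_vec C e = (if e \<in> set C then 1 / length C else 0)"
  unfolding cycle_vec_def by (induction C) auto

lemma sum_cycle_vec:
  assumes "finite E" "cycle E st ar C"
  shows "sum (cycle_vec C) E = 1"
proof -
  have "(\<Sum>e\<in>E. count_list C e) = length C"
    using assms by (intro sum_count_set) (auto simp: cycle_def walk_def)
  then show ?thesis
    using assms(2) by (simp add: cycle_vec_def cycle_def flip: sum_divide_distrib of_nat_sum)
qed

lemma first_repetition:
  fixes f :: "nat \<Rightarrow> 'a"
  assumes "finite (range f)"
  obtains i j where "i < j" "f i = f j" "inj_on f {..<j}"
proof -
  have "\<exists>j. \<not> inj_on f {..j}"
  proof (rule ccontr)
    assume "\<nexists>j. \<not> inj_on f {..j}"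
    then have "inj f"
      by (intro injI) (metis atMost_iff inj_onD linear order_refl)
    then show False
      using assms by (simp add: finite_image_iff)
  qed
  then obtain j where not_inj: "\<not> inj_on f {..j}" and minimal: "\<And>j'. j' < j \<Longrightarrow> inj_on f {..j'}"
    unfolding exists_least_iff[of "\<lambda>j. \<not> inj_on f {..j}"] by blast
  have inj: "inj_on f {..<j}"
    using minimal by (cases j) (auto simp: lessThan_Suc_atMost)
  moreover have "{..j} = insert j {..<j}"
    by auto
  ultimately obtain i where "i < j" "f i = f j"
    using not_inj by auto
  then show ?thesis
    using inj by (rule that)
qed

lemma exists_simple_cycle:
  assumes "finite S" "S \<noteq> {}"
    and next_edge: "\<And>e. e \<in> S \<Longrightarrow> \<exists>e'\<in>S. st e' = ar e"
  obtains C where "simple_cycle S st ar C"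
proof -
  obtain nxt where nxt: "\<And>e. e \<in> S \<Longrightarrow> nxt e \<in> S \<and> st (nxt e) = ar e"
    using next_edge by metis
  obtain e0 where "e0 \<in> S" using assms(2) by blast
  define x where "x i = (nxt ^^ i) e0" for i :: nat
  have x_in: "x i \<in> S" for i
    by (induction i) (auto simp: x_def \<open>e0 \<in> S\<close> nxt)
  have st_x_Suc: "st (x (Suc i)) = ar (x i)" for i
    using nxt[OF x_in[of i]] by (simp add: x_def)
  have "finite (range (\<lambda>i. st (x i)))"
    using x_in by (intro finite_subset[OF _ finite_imageI[OF assms(1), of st]]) auto
  then obtain i j where ij: "i < j" "st (x i) = st (x j)" and inj: "inj_on (\<lambda>i. st (x i)) {..<j}"
    by (rule first_repetition)
  let ?C = "map x [i..<j]"
  have "distinct (map st ?C)"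
    using inj by (auto simp: distinct_map comp_def intro: inj_on_subset)
  moreover from this have "distinct ?C"
    by (simp only: distinct_map)
  moreover obtain j' where "j = Suc j'"
    using ij(1) by (cases j) auto
  then have "st (hd ?C) = ar (last ?C)"
    using ij st_x_Suc[of j'] by (simp add: hd_map last_map del: upt_Suc)
  moreover have "walk S st ar ?C"
    using x_in st_x_Suc by (auto simp: walk_def)
  ultimately have "simple_cycle S st ar ?C"
    using ij(1) by (simp add: simple_cycle_def cycle_def)
  then show ?thesis
    by (rule that)
qed

lemma exists_simple_cycle_in_support:
  assumes "finite E" "circulation E st ar f" "\<And>e. 0 \<le> f e" "f \<noteq> 0"
  obtains C where "simple_cycle {e \<in> E. 0 < f e} st ar C"
proof (rule exists_simple_cycle[of "{e \<in> E. 0 < f e}" st ar])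
  have "\<exists>e. f e \<noteq> 0"
    using assms(4) by (auto simp: fun_eq_iff)
  then show "{e \<in> E. 0 < f e} \<noteq> {}"
    using assms(2,3) by (auto simp: circulation_def less_le)
  show "\<exists>e'\<in>{e \<in> E. 0 < f e}. st e' = ar e" if "e \<in> {e \<in> E. 0 < f e}" for e
  proof -
    have "0 < (\<Sum>e' | e' \<in> E \<and> ar e' = ar e. f e')"
      using that assms(1,3) by (intro sum_pos2[of _ e]) auto
    also have "\<dots> = (\<Sum>e' | e' \<in> E \<and> st e' = ar e. f e')"
      using assms(2) by (simp add: circulation_def)
    finally obtain e' where "e' \<in> E" "st e' = ar e" "f e' \<noteq> 0"
      by (metis (mono_tags, lifting) mem_Collect_eq order_less_irrefl sum.neutral)
    then show ?thesis
      using assms(3)[of e'] by auto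
  qed
qed (use assms(1) that in auto)

lemma circulation_minus_cycle:
  assumes "finite E" "circulation E st ar f" "\<And>e. 0 \<le> f e" "f \<noteq> 0"
  obtains C c where "simple_cycle E st ar C" "0 \<le> c"
    "circulation E st ar (f - c *\<^sub>R cycle_vec C)" "\<And>e. 0 \<le> (f - c *\<^sub>R cycle_vec C) e"
    "{e \<in> E. 0 < (f - c *\<^sub>R cycle_vec C) e} \<subset> {e \<in> E. 0 < f e}"
proof -
  obtain C where C: "simple_cycle {e \<in> E. 0 < f e} st ar C"
    using exists_simple_cycle_in_support[OF assms] .
  then have support: "set C \<subseteq> {e \<in> E. 0 < f e}" and "C \<noteq> []" "distinct C"
    by (auto simp: simple_cycle_def cycle_def walk_def)
  have simple: "simple_cycle E st ar C"
    using C by (rule simple_cycle_mono) auto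
  define m where "m = Min (f ` set C)"
  have m_le: "m \<le> f e" if "e \<in> set C" for e
    using that by (simp add: m_def)
  have "m \<in> f ` set C"
    using \<open>C \<noteq> []\<close> by (simp add: m_def)
  then obtain e0 where e0: "e0 \<in> set C" "f e0 = m" by blast
  then have "m > 0" using support by auto
  define g where "g = f - (m * length C) *\<^sub>R cycle_vec C"
  have g_apply: "g e = (if e \<in> set C then f e - m else f e)" for e
    using \<open>C \<noteq> []\<close> \<open>distinct C\<close> by (simp add: g_def cycle_vec_distinct)
  have "circulation E st ar (cycle_vec C)"
    using assms(1) simple by (simp add: simple_cycle_def circulation_cycle_vec)
  then have "g \<in> {f. circulation E st ar f}"
    unfolding g_def using assms(2)
    by (intro subspace_diff subspace_scale subspace_circulations) simp_all
  then have "circulation E st ar g" by simp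
  moreover have "0 \<le> g e" for e
    using m_le assms(3) by (simp add: g_apply)
  moreover have "{e \<in> E. 0 < g e} \<subset> {e \<in> E. 0 < f e}"
  proof
    show "{e \<in> E. 0 < g e} \<subseteq> {e \<in> E. 0 < f e}"
      using \<open>m > 0\<close> by (auto simp: g_apply split: if_splits)
    show "{e \<in> E. 0 < g e} \<noteq> {e \<in> E. 0 < f e}"
      using e0 support by (auto simp: g_apply set_eq_iff)
  qed
  ultimately show ?thesis
    using simple \<open>m > 0\<close> by (intro that[of C "m * length C"]) (simp_all add: g_def)
qed

lemma circulation_in_convex_cone_hull:
  assumes "finite E" "circulation E st ar f" "\<And>e. 0 \<le> f e"
  shows "f \<in> convex_cone hull {cycle_vec C | C. simple_cycle E st ar C}" (is "_ \<in> ?K")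
  using assms(2,3)
proof (induction "card {e \<in> E. 0 < f e}" arbitrary: f rule: less_induct)
  case less
  show ?case
  proof (cases "f = 0")
    case True
    then show ?thesis by (simp add: convex_cone_hull_contains_0)
  next
    case False
    obtain C c where C: "simple_cycle E st ar C" "0 \<le> c"
      and rest: "circulation E st ar (f - c *\<^sub>R cycle_vec C)" "\<And>e. 0 \<le> (f - c *\<^sub>R cycle_vec C) e"
      and smaller: "{e \<in> E. 0 < (f - c *\<^sub>R cycle_vec C) e} \<subset> {e \<in> E. 0 < f e}"
      using circulation_minus_cycle[OF assms(1) less.prems False] by blast
    have "f - c *\<^sub>R cycle_vec C \<in> ?K"
      using smaller assms(1) rest by (intro less.hyps psubset_card_mono) auto
    moreover have "c *\<^sub>R cycle_vec C \<in> ?K"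
      using C by (intro convex_cone_hull_mul hull_inc) auto
    ultimately have "(f - c *\<^sub>R cycle_vec C) + c *\<^sub>R cycle_vec C \<in> ?K"
      by (rule convex_cone_hull_add)
    then show ?thesis by simp
  qed
qed

lemma convex_cone_hull_level_set:
  assumes "linear \<phi>" "\<And>x. x \<in> S \<Longrightarrow> \<phi> x = (1::real)" "f \<in> convex_cone hull S" "\<phi> f = 1"
  shows "f \<in> convex hull S"
proof -
  have "convex {x. \<phi> x = 1}"
    using assms(1) by (auto simp: convex_def linear_add linear_scale)
  then have level: "\<phi> x = 1" if "x \<in> convex hull S" for x
    using hull_minimal[of S "{x. \<phi> x = 1}" convex] assms(2) that by blast
  have "f \<noteq> 0"
    using assms(1,4) linear_0 by fastforce
  then obtain c x where "f = c *\<^sub>R x" "x \<in> convex hull S"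
    using assms(3) by (auto simp: convex_cone_hull_separate conic_hull_explicit)
  moreover from this have "c = 1"
    using assms(1,4) level by (simp add: linear_scale)
  ultimately show ?thesis by simp
qed

lemma unit_circulation_in_cycle_polytope:
  assumes "finite E" "circulation E st ar f" "\<And>e. 0 \<le> f e" "sum f E = 1"
  shows "f \<in> cycle_polytope E st ar"
  unfolding cycle_polytope_def
proof (rule convex_cone_hull_level_set)
  show "linear (\<lambda>f. sum f E :: real)"
    by (rule linear_sum_fun)
  show "f \<in> convex_cone hull {cycle_vec C | C. simple_cycle E st ar C}"
    using assms(1-3) by (rule circulation_in_convex_cone_hull)
  show "sum v E = 1" if "v \<in> {cycle_vec C | C. simple_cycle E st ar C}" for v
    using that assms(1) by (auto simp: simple_cycle_def sum_cycle_vec)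
qed (rule assms(4))

section \<open>Dimension of the space of circulations\<close>

lemma sum_fun_apply: "(\<Sum>i\<in>I. f i) x = (\<Sum>i\<in>I. f i x)"
  by (induction I rule: infinite_finite_induct) auto

lemma finite_support_in_span_units:
  fixes f :: "'e \<Rightarrow> real"
  assumes "finite F" "\<And>e. e \<notin> F \<Longrightarrow> f e = 0"
  shows "f \<in> span ((\<lambda>a e. if e = a then 1 else 0) ` F)" (is "_ \<in> span (?unit ` F)")
proof -
  have "(\<Sum>a\<in>F. f a *\<^sub>R ?unit a) e = f e" for e
    using assms by (cases "e \<in> F") (simp_all add: sum_fun_apply if_distrib cong: if_cong)
  then have "f = (\<Sum>a\<in>F. f a *\<^sub>R ?unit a)"
    by (intro ext) (rule sym)
  also have "\<dots> \<in> span (?unit ` F)"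
    by (intro span_sum span_scale span_base) simp
  finally show ?thesis .
qed

lemma dim_le_card_determining_set:
  fixes D :: "('e \<Rightarrow> real) set"
  assumes "finite F" and determining: "\<And>f. f \<in> span D \<Longrightarrow> (\<And>e. e \<in> F \<Longrightarrow> f e = 0) \<Longrightarrow> f = 0"
  shows "dim D \<le> card F"
proof -
  define restrict_F :: "('e \<Rightarrow> real) \<Rightarrow> 'e \<Rightarrow> real" where
    "restrict_F f = (\<lambda>e. if e \<in> F then f e else 0)" for f
  let ?units = "(\<lambda>a e. if e = a then 1 else (0::real)) ` F"
  have lin: "linear restrict_F"
    by (intro linearI) (auto simp: restrict_F_def fun_eq_iff)
  have "f = 0" if "f \<in> span D" "restrict_F f = 0" for f
  proof (rule determining[OF that(1)])
    show "f e = 0" if "e \<in> F" for e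
      using that fun_cong[OF \<open>restrict_F f = 0\<close>, of e] by (simp add: restrict_F_def)
  qed
  then have inj: "inj_on restrict_F (span D)"
    by (simp add: linear_inj_on_iff_eq_0[OF lin])
  obtain b where b: "b \<subseteq> D" "independent b" "D \<subseteq> span b" "card b = dim D"
    using basis_exists[of D] by blast
  have inj_b: "inj_on restrict_F (span b)"
    using inj by (rule inj_on_subset) (use b(1) in \<open>rule span_mono\<close>)
  then have "independent (restrict_F ` b)"
    using lin b(2) by (intro linear_independent_injective_image)
  moreover have "restrict_F f \<in> span ?units" for f
    using assms(1) by (rule finite_support_in_span_units) (simp add: restrict_F_def)
  then have "restrict_F ` b \<subseteq> span ?units"
    by blast
  ultimately have "card (restrict_F ` b) \<le> card ?units"
    using assms(1) by (intro independent_span_bound[THEN conjunct2]) simp_all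
  also have "\<dots> \<le> card F"
    using assms(1) by (rule card_image_le)
  also have "card (restrict_F ` b) = card b"
    using inj_b by (intro card_image) (meson inj_on_subset span_superset)
  finally show ?thesis
    using b(4) by simp
qed

definition invariant_on :: "'v set \<Rightarrow> ('v \<Rightarrow> 'v) \<Rightarrow> ('v \<Rightarrow> real) \<Rightarrow> bool" where
  "invariant_on V N g \<longleftrightarrow> (\<forall>x\<in>V. g x = (\<Sum>y | y \<in> V \<and> N y = x. g y))"

definition rooted_at :: "'v set \<Rightarrow> ('v \<Rightarrow> 'v) \<Rightarrow> 'v \<Rightarrow> bool" where
  "rooted_at V N r \<longleftrightarrow> N ` V \<subseteq> V \<and> (\<forall>P\<subseteq>V. P \<noteq> {} \<longrightarrow> N ` P \<subseteq> P \<longrightarrow> r \<in> P)"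

text \<open>The positive part of g is at most its sum over preimages; as both have the same total over V,
  equality holds at every point.\<close>

lemma invariant_on_pos_part_mono:
  assumes "finite V" "N ` V \<subseteq> V" "invariant_on V N g" "y \<in> V"
  shows "max 0 (g y) \<le> max 0 (g (N y))"
proof -
  let ?p = "\<lambda>x. max 0 (g x)" and ?q = "\<lambda>x. \<Sum>y | y \<in> V \<and> N y = x. max 0 (g y)"
  have le: "?p x \<le> ?q x" if "x \<in> V" for x
  proof -
    have "g x = (\<Sum>y | y \<in> V \<and> N y = x. g y)"
      using assms(3) that by (simp add: invariant_on_def)
    then have "g x \<le> ?q x"
      by (simp add: sum_mono)
    then show ?thesis
      by (simp add: sum_nonneg)
  qed
  have "sum ?q V = sum ?p V"
    using assms(1,2) by (intro sum.group)
  then have "(\<Sum>x\<in>V. ?q x - ?p x) = 0"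
    by (simp add: sum_subtractf)
  moreover have "N y \<in> V"
    using assms(2,4) by blast
  ultimately have "?q (N y) - ?p (N y) = 0"
    using le assms(1) by (subst (asm) sum_nonneg_eq_0_iff) auto
  moreover have "?p y \<le> ?q (N y)"
    using assms(1,4) by (intro member_le_sum) auto
  ultimately show ?thesis
    by simp
qed

lemma invariant_on_positive_at_root:
  assumes "finite V" "rooted_at V N r" "invariant_on V N g" "x \<in> V" "0 < g x"
  shows "0 < g r"
proof -
  let ?P = "{y \<in> V. 0 < g y}"
  have stays: "N ` V \<subseteq> V"
    using assms(2) by (simp add: rooted_at_def)
  have "0 < g (N y)" if "y \<in> V" "0 < g y" for y
    using invariant_on_pos_part_mono[OF assms(1) stays assms(3) that(1)] that(2) by simp
  then have "N ` ?P \<subseteq> ?P"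
    using stays by auto
  moreover have "?P \<subseteq> V" "?P \<noteq> {}"
    using assms(4,5) by auto
  ultimately have "r \<in> ?P"
    using assms(2) unfolding rooted_at_def by blast
  then show ?thesis by simp
qed

lemma invariant_on_sum_zero_eq_zero:
  assumes "finite V" "rooted_at V N r" "invariant_on V N g" "sum g V = 0" "x \<in> V"
  shows "g x = 0"
proof -
  have pos: "0 < g r" if "y \<in> V" "0 < g y" for y
    using invariant_on_positive_at_root[OF assms(1-3) that] .
  have "invariant_on V N (\<lambda>x. - g x)"
    using assms(3) by (simp add: invariant_on_def sum_negf)
  then have neg: "g r < 0" if "y \<in> V" "g y < 0" for y
    using invariant_on_positive_at_root[OF assms(1,2), of "\<lambda>x. - g x" y] that by simp
  consider (nonneg) "\<forall>y\<in>V. 0 \<le> g y" | (nonpos) "\<forall>y\<in>V. 0 \<le> - g y"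
    using pos neg by force
  then show ?thesis
  proof cases
    case nonneg
    then show ?thesis
      using sum_nonneg_eq_0_iff[OF assms(1), of g] assms(4,5) by simp
  next
    case nonpos
    then show ?thesis
      using sum_nonneg_eq_0_iff[OF assms(1), of "\<lambda>y. - g y"] assms(4,5) by (simp add: sum_negf)
  qed
qed

lemma sum_supported_on_choice:
  fixes d :: "'e \<Rightarrow> real" and t :: "'v \<Rightarrow> 'e"
  assumes "finite E" and choice: "\<And>x. x \<in> V \<Longrightarrow> t x \<in> E \<and> st (t x) = x"
    and support: "\<And>e. e \<notin> t ` V \<Longrightarrow> d e = 0"
  shows "(\<Sum>e | e \<in> E \<and> Q e. d e) = (\<Sum>x | x \<in> V \<and> Q (t x). d (t x))"
proof -
  have "(\<Sum>e | e \<in> E \<and> Q e. d e) = sum d (t ` {x \<in> V. Q (t x)})"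
  proof (rule sum.mono_neutral_right)
    show "finite {e \<in> E. Q e}"
      using assms(1) by simp
    show "t ` {x \<in> V. Q (t x)} \<subseteq> {e \<in> E. Q e}"
      using choice by blast
    show "\<forall>e\<in>{e \<in> E. Q e} - t ` {x \<in> V. Q (t x)}. d e = 0"
    proof
      fix e assume "e \<in> {e \<in> E. Q e} - t ` {x \<in> V. Q (t x)}"
      then have "e \<notin> t ` V" by auto
      then show "d e = 0" by (rule support)
    qed
  qed
  also have "inj_on t {x \<in> V. Q (t x)}"
    using choice by (intro inj_on_inverseI[of _ st]) simp
  then have "sum d (t ` {x \<in> V. Q (t x)}) = (\<Sum>x | x \<in> V \<and> Q (t x). d (t x))"
    by (rule sum.reindex_cong) simp_all
  finally show ?thesis .
qed

lemma circulation_on_choice_eq_zero: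
  fixes d :: "'e \<Rightarrow> real" and t :: "'v \<Rightarrow> 'e"
  assumes "finite V" "finite E" and choice: "\<And>x. x \<in> V \<Longrightarrow> t x \<in> E \<and> st (t x) = x"
    and root: "rooted_at V (\<lambda>x. ar (t x)) r"
    and d: "circulation E st ar d" "sum d E = 0" and support: "\<And>e. e \<notin> t ` V \<Longrightarrow> d e = 0"
  shows "d = 0"
proof -
  note sum_d = sum_supported_on_choice[OF assms(2) choice support]
  have "d (t x) = (\<Sum>y | y \<in> V \<and> ar (t y) = x. d (t y))" if "x \<in> V" for x
  proof -
    have "{y \<in> V. st (t y) = x} = {x}"
      using choice that by auto
    then have "d (t x) = (\<Sum>y | y \<in> V \<and> st (t y) = x. d (t y))"
      by simp
    also have "\<dots> = (\<Sum>e | e \<in> E \<and> st e = x. d e)"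
      by (rule sum_d[symmetric])
    also have "\<dots> = (\<Sum>e | e \<in> E \<and> ar e = x. d e)"
      using d(1) by (simp add: circulation_def)
    also have "\<dots> = (\<Sum>y | y \<in> V \<and> ar (t y) = x. d (t y))"
      by (rule sum_d)
    finally show ?thesis .
  qed
  then have "invariant_on V (\<lambda>x. ar (t x)) (\<lambda>x. d (t x))"
    unfolding invariant_on_def by blast
  moreover have "(\<Sum>x\<in>V. d (t x)) = 0"
    using sum_d[where Q = "\<lambda>_. True"] d(2) by simp
  ultimately have "d (t x) = 0" if "x \<in> V" for x
    using invariant_on_sum_zero_eq_zero[OF assms(1) root _ _ that] by blast
  then have "d e = 0" for e
    using support[of e] by (cases "e \<in> t ` V") auto
  then show ?thesis
    by (simp add: fun_eq_iff)
qed

definition strongly_connected :: "'v set \<Rightarrow> 'e set \<Rightarrow> ('e \<Rightarrow> 'v) \<Rightarrow> ('e \<Rightarrow> 'v) \<Rightarrow> bool" where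
  "strongly_connected V E st ar \<longleftrightarrow> (\<forall>x\<in>V. \<forall>y\<in>V. (x, y) \<in> ((\<lambda>e. (st e, ar e)) ` E)\<^sup>+)"

lemma strongly_connected_depth:
  assumes "strongly_connected V E st ar" "r \<in> V"
  obtains depth :: "'v \<Rightarrow> nat"
  where "\<And>x. x \<in> V \<Longrightarrow> \<exists>e\<in>E. st e = x \<and> (x \<noteq> r \<longrightarrow> depth (ar e) < depth x)"
proof
  let ?R = "(\<lambda>e. (st e, ar e)) ` E"
  let ?depth = "\<lambda>x. LEAST n. (x, r) \<in> ?R ^^ n"
  fix x assume "x \<in> V"
  then have connected: "(x, r) \<in> ?R\<^sup>+"
    using assms by (simp add: strongly_connected_def)
  have depth: "(x, r) \<in> ?R ^^ ?depth x"
    using rtrancl_imp_relpow[OF trancl_into_rtrancl[OF connected]] by (rule LeastI_ex)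
  show "\<exists>e\<in>E. st e = x \<and> (x \<noteq> r \<longrightarrow> ?depth (ar e) < ?depth x)"
  proof (cases "x = r")
    case True
    then show ?thesis
      using tranclD[OF connected] by auto
  next
    case False
    with depth obtain n where n: "?depth x = Suc n" by (cases "?depth x") auto
    with depth have "(x, r) \<in> ?R ^^ Suc n" by simp
    then obtain y where y: "(x, y) \<in> ?R" "(y, r) \<in> ?R ^^ n" by (rule relpow_Suc_E2)
    have "?depth y \<le> n"
      using y(2) by (rule Least_le)
    with y(1) n show ?thesis by auto
  qed
qed

lemma strongly_connected_choice:
  assumes "strongly_connected V E st ar" "\<And>e. e \<in> E \<Longrightarrow> ar e \<in> V"
  obtains t r where "\<And>x. x \<in> V \<Longrightarrow> t x \<in> E \<and> st (t x) = x" "rooted_at V (\<lambda>x. ar (t x)) r"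
proof (cases "V = {}")
  case True
  then show ?thesis by (intro that[of undefined undefined]) (auto simp: rooted_at_def)
next
  case False
  then obtain r where "r \<in> V" by blast
  obtain depth :: "'a \<Rightarrow> nat"
    where "\<And>x. x \<in> V \<Longrightarrow> \<exists>e\<in>E. st e = x \<and> (x \<noteq> r \<longrightarrow> depth (ar e) < depth x)"
    using strongly_connected_depth[OF assms(1) \<open>r \<in> V\<close>] by blast
  then obtain t where "\<forall>x\<in>V. t x \<in> E \<and> st (t x) = x \<and> (x \<noteq> r \<longrightarrow> depth (ar (t x)) < depth x)"
    by metis
  then have t: "\<And>x. x \<in> V \<Longrightarrow> t x \<in> E \<and> st (t x) = x"
    and descends: "\<And>x. x \<in> V \<Longrightarrow> x \<noteq> r \<Longrightarrow> depth (ar (t x)) < depth x"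
    by blast+
  have "r \<in> P" if "P \<subseteq> V" "(\<lambda>x. ar (t x)) ` P \<subseteq> P" "x \<in> P" for P x
    using that(3)
  proof (induction "depth x" arbitrary: x rule: less_induct)
    case less
    show ?case
    proof (cases "x = r")
      case False
      then have "depth (ar (t x)) < depth x" "ar (t x) \<in> P"
        using descends less.prems that(1,2) by blast+
      then show ?thesis by (rule less.hyps)
    qed (use less.prems in simp)
  qed
  moreover have "(\<lambda>x. ar (t x)) ` V \<subseteq> V"
    using t assms(2) by blast
  ultimately have "rooted_at V (\<lambda>x. ar (t x)) r"
    unfolding rooted_at_def by blast
  with t show ?thesis by (rule that)
qed

lemma card_plus_dim_circulations_le:
  assumes "finite V" "finite E" "\<And>e. e \<in> E \<Longrightarrow> ar e \<in> V" and "strongly_connected V E st ar"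
    and D: "D \<subseteq> {d. circulation E st ar d \<and> sum d E = 0}"
  shows "card V + dim D \<le> card E"
proof -
  obtain t r where t: "\<And>x. x \<in> V \<Longrightarrow> t x \<in> E \<and> st (t x) = x"
    and root: "rooted_at V (\<lambda>x. ar (t x)) r"
    using strongly_connected_choice[OF assms(4,3)] by blast
  have "inj_on t V"
    using t by (intro inj_on_inverseI[of _ st]) simp
  then have card_image_t: "card (t ` V) = card V"
    by (rule card_image)
  have image_t: "t ` V \<subseteq> E"
    using t by blast
  have "subspace ({d. circulation E st ar d} \<inter> {d. sum d E = 0})"
    by (intro subspace_inter subspace_circulations linear_subspace_kernel linear_sum_fun)
  with D have span_D: "span D \<subseteq> {d. circulation E st ar d \<and> sum d E = 0}"
    unfolding Collect_conj_eq by (rule span_minimal)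
  have "dim D \<le> card (E - t ` V)"
  proof (rule dim_le_card_determining_set)
    fix f assume "f \<in> span D" and zero: "\<And>e. e \<in> E - t ` V \<Longrightarrow> f e = 0"
    then have f: "circulation E st ar f" "sum f E = 0"
      using span_D by auto
    then have "f e = 0" if "e \<notin> t ` V" for e
      using that zero by (cases "e \<in> E") (auto simp: circulation_def)
    then show "f = 0"
      using circulation_on_choice_eq_zero[OF assms(1,2) t root f] by blast
  qed (use assms(2) in simp)
  moreover have "card (E - t ` V) = card E - card V"
    using image_t card_image_t assms(1) by (simp add: card_Diff_subset)
  moreover have "card V \<le> card E"
    using card_mono[OF assms(2) image_t] card_image_t by simp
  ultimately show ?thesis by simp
qed

lemma affine_unit_circulations: "affine {v. circulation E st ar v \<and> sum v E = 1}"
proof -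
  have "affine {v. sum v E = (1::real)}"
    by (auto simp: affine_def sum.distrib simp flip: sum_distrib_left)
  then show ?thesis
    unfolding Collect_conj_eq by (rule affine_Int[OF subspace_imp_affine[OF subspace_circulations]])
qed

lemma affine_dim_unit_circulations_le:
  assumes "finite V" "finite E" "\<And>e. e \<in> E \<Longrightarrow> ar e \<in> V" "strongly_connected V E st ar"
    and S: "S \<subseteq> {v. circulation E st ar v \<and> sum v E = 1}"
  shows "affine_dim S \<le> int (card E) - int (card V)"
proof -
  let ?D = "{x - y | x y. x \<in> affine hull S \<and> y \<in> affine hull S}"
  have "affine hull S \<subseteq> {v. circulation E st ar v \<and> sum v E = 1}"
    using S affine_unit_circulations by (rule hull_minimal)
  moreover have "circulation E st ar (x - y) \<and> sum (x - y) E = 0"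
    if "circulation E st ar x \<and> sum x E = 1" "circulation E st ar y \<and> sum y E = 1" for x y
    using that subspace_diff[OF subspace_circulations, of x E st ar y] by (simp add: sum_subtractf)
  ultimately have "?D \<subseteq> {d. circulation E st ar d \<and> sum d E = 0}"
    by blast
  from card_plus_dim_circulations_le[OF assms(1-4) this] show ?thesis
    by (auto simp: affine_dim_def)
qed

section \<open>Feasible vectors\<close>

lemma tendsto_fun_iff: "(f \<longlongrightarrow> l) F \<longleftrightarrow> (\<forall>i. ((\<lambda>x. f x i) \<longlongrightarrow> l i) F)"
  using limitin_componentwise[of "\<lambda>_. euclidean" UNIV f l F]
  by (simp add: euclidean_product_topology)

lemma tendsto_bounded_over_at_top:
  fixes a :: "'a \<Rightarrow> real" and n :: "'a \<Rightarrow> nat"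
  assumes "filterlim n at_top F" "\<And>x. \<bar>a x\<bar> \<le> c"
  shows "((\<lambda>x. a x / n x) \<longlongrightarrow> 0) F"
proof (rule Lim_null_comparison)
  show "((\<lambda>x. c / n x) \<longlongrightarrow> 0) F"
    using assms(1) by (intro tendsto_divide_0[OF tendsto_const] filterlim_at_top_imp_at_infinity
      filterlim_compose[OF filterlim_real_sequentially])
  show "\<forall>\<^sub>F x in F. norm (a x / n x) \<le> c / n x"
    using assms(2) by (intro always_eventually allI) (simp add: divide_right_mono)
qed

lemma sequence_tendsto_iff_closures:
  fixes f :: "'a \<Rightarrow> 'b::metric_space" and size_of :: "'a \<Rightarrow> nat"
  shows "(\<exists>\<sigma>. (\<forall>m. \<sigma> m \<in> S) \<and> filterlim (\<lambda>m. size_of (\<sigma> m)) at_top sequentially \<and> (\<lambda>m. f (\<sigma> m)) \<longlonglongrightarrow> v)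
    \<longleftrightarrow> v \<in> (\<Inter>N. closure (f ` {x \<in> S. N \<le> size_of x}))" (is "?seq \<longleftrightarrow> ?closures")
proof
  assume ?seq
  then obtain \<sigma> where \<sigma>: "\<And>m. \<sigma> m \<in> S" "filterlim (\<lambda>m. size_of (\<sigma> m)) at_top sequentially"
    "(\<lambda>m. f (\<sigma> m)) \<longlonglongrightarrow> v"
    by blast
  have "v \<in> closure (f ` {x \<in> S. N \<le> size_of x})" for N
  proof (rule Lim_in_closed_set[OF closed_closure _ _ \<sigma>(3)])
    have "\<forall>\<^sub>F m in sequentially. N \<le> size_of (\<sigma> m)"
      using \<sigma>(2) by (simp add: filterlim_at_top)
    then show "\<forall>\<^sub>F m in sequentially. f (\<sigma> m) \<in> closure (f ` {x \<in> S. N \<le> size_of x})"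
      by (rule eventually_mono) (use \<sigma>(1) in \<open>auto intro!: subsetD[OF closure_subset]\<close>)
  qed simp
  then show ?closures by blast
next
  assume ?closures
  then have "\<exists>x\<in>S. m \<le> size_of x \<and> dist (f x) v < inverse (Suc m)" for m
    using closure_approachableD[of v "f ` {x \<in> S. m \<le> size_of x}" "inverse (Suc m)"]
    by (auto simp: dist_commute simp del: of_nat_Suc)
  then obtain \<sigma> where \<sigma>: "\<And>m. \<sigma> m \<in> S" "\<And>m. m \<le> size_of (\<sigma> m)"
    "\<And>m. dist (f (\<sigma> m)) v < inverse (Suc m)"
    by metis
  have "filterlim (\<lambda>m. size_of (\<sigma> m)) at_top sequentially"
    by (rule filterlim_at_top_mono[OF filterlim_ident]) (simp add: \<sigma>(2))
  moreover have "(\<lambda>m. f (\<sigma> m)) \<longlonglongrightarrow> v"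
    using \<sigma>(3) by (intro metric_tendsto_imp_tendsto[OF LIMSEQ_inverse_real_of_nat])
      (auto intro!: always_eventually less_imp_le)
  ultimately show ?seq
    using \<sigma>(1) by blast
qed

definition cocc_vec :: "nat \<Rightarrow> nat list \<Rightarrow> nat list \<Rightarrow> real" where
  "cocc_vec k \<sigma> = (\<lambda>\<pi>. if \<pi> \<in> perms k then cocc_prop \<pi> \<sigma> else 0)"

lemma tendsto_cocc_vec_iff:
  assumes "\<And>\<pi>. \<pi> \<notin> perms k \<Longrightarrow> v \<pi> = 0"
  shows "((\<lambda>m. cocc_vec k (\<sigma> m)) \<longlongrightarrow> v) F
    \<longleftrightarrow> (\<forall>\<pi>\<in>perms k. ((\<lambda>m. cocc_prop \<pi> (\<sigma> m)) \<longlongrightarrow> v \<pi>) F)"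
proof -
  have "((\<lambda>m. cocc_vec k (\<sigma> m) \<pi>) \<longlongrightarrow> v \<pi>) F
      \<longleftrightarrow> (\<pi> \<in> perms k \<longrightarrow> ((\<lambda>m. cocc_prop \<pi> (\<sigma> m)) \<longlongrightarrow> v \<pi>) F)" for \<pi>
    using assms by (cases "\<pi> \<in> perms k") (simp_all add: cocc_vec_def)
  then show ?thesis
    by (simp add: tendsto_fun_iff Ball_def)
qed

lemma cocc_le_length:
  assumes "\<pi> \<noteq> []"
  shows "cocc \<pi> \<sigma> \<le> length \<sigma>"
proof -
  have "window_positions \<pi> \<sigma> \<subseteq> {..<length \<sigma>}"
    using assms by (cases \<pi>) (auto simp: window_positions_def)
  from card_mono[OF _ this] show ?thesis
    using assms by (simp add: cocc_eq_card_window_positions)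
qed

lemma Nil_notin_perms: "k \<ge> 1 \<Longrightarrow> [] \<notin> perms k"
  by (simp add: perms_def)

lemma cocc_vec_in_cube:
  assumes "k \<ge> 1"
  shows "cocc_vec k \<sigma> \<in> cube k"
proof -
  have "cocc_prop \<pi> \<sigma> \<le> 1" if "\<pi> \<in> perms k" for \<pi>
    using cocc_le_length[of \<pi> \<sigma>] that Nil_notin_perms[OF assms]
    by (auto simp: cocc_prop_def divide_le_eq_1)
  then show ?thesis
    by (simp add: cube_def cocc_vec_def cocc_prop_def)
qed

lemma closed_cube: "closed (cube k)"
proof -
  have "cube k = (\<Inter>\<pi>. (\<lambda>v. v \<pi>) -` (if \<pi> \<in> perms k then {0..1} else {0}))"
    by (auto simp: cube_def split: if_splits)
  then show ?thesis
    by (auto intro!: closed_vimage)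
qed

lemma feasible_iff_tendsto:
  assumes "k \<ge> 1"
  shows "v \<in> feasible k B \<longleftrightarrow> (\<exists>\<sigma>. (\<forall>m. \<sigma> m \<in> Av B)
    \<and> filterlim (\<lambda>m. length (\<sigma> m)) at_top sequentially \<and> (\<lambda>m. cocc_vec k (\<sigma> m)) \<longlonglongrightarrow> v)"
proof -
  have "v \<in> cube k" if "(\<lambda>m. cocc_vec k (\<sigma> m)) \<longlonglongrightarrow> v" for \<sigma>
    using cocc_vec_in_cube[OF assms] by (intro Lim_in_closed_set[OF closed_cube _ _ that]) simp_all
  moreover have "(\<lambda>m. cocc_vec k (\<sigma> m)) \<longlonglongrightarrow> v \<longleftrightarrow> (\<forall>\<pi>\<in>perms k. (\<lambda>m. cocc_prop \<pi> (\<sigma> m)) \<longlonglongrightarrow> v \<pi>)"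
    if "v \<in> cube k" for \<sigma>
    using that by (intro tendsto_cocc_vec_iff) (simp add: cube_def)
  ultimately show ?thesis
    unfolding feasible_def by blast
qed

lemma less_Suc_mult: "0 < n \<Longrightarrow> m < Suc m * n"
  by (cases n) auto

lemma feasible_if_scaled_tendsto:
  fixes d :: "nat \<Rightarrow> nat"
  assumes "k \<ge> 1" and Av: "\<And>m. \<sigma> m \<in> Av B"
    and scale: "\<And>m. m < d m" and len: "(\<lambda>m. length (\<sigma> m) / d m) \<longlonglongrightarrow> 1"
    and lim: "\<And>\<pi>. \<pi> \<in> perms k \<Longrightarrow> (\<lambda>m. cocc \<pi> (\<sigma> m) / d m) \<longlonglongrightarrow> v \<pi>"
    and zero: "\<And>\<pi>. \<pi> \<notin> perms k \<Longrightarrow> v \<pi> = 0"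
  shows "v \<in> feasible k B"
proof -
  have d_pos: "0 < d m" for m
    using scale[of m] by simp
  have "filterlim (\<lambda>m. real (d m)) at_top sequentially"
    using scale
    by (intro filterlim_at_top_mono[OF filterlim_real_sequentially] always_eventually allI)
      (simp add: less_imp_le)
  from filterlim_tendsto_pos_mult_at_top[OF len _ this]
  have "filterlim (\<lambda>m. length (\<sigma> m)) at_top sequentially"
    using d_pos by (simp add: filterlim_sequentially_iff_filterlim_real)
  moreover have "(\<lambda>m. cocc_prop \<pi> (\<sigma> m)) \<longlonglongrightarrow> v \<pi>" if "\<pi> \<in> perms k" for \<pi>
    using tendsto_divide[OF lim[OF that] len] d_pos by (simp add: cocc_prop_def)
  then have "(\<lambda>m. cocc_vec k (\<sigma> m)) \<longlonglongrightarrow> v"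
    using zero by (simp add: tendsto_cocc_vec_iff)
  ultimately show ?thesis
    using Av by (auto simp: feasible_iff_tendsto[OF assms(1)])
qed

lemma closed_feasible:
  assumes "k \<ge> 1"
  shows "closed (feasible k B)"
proof -
  have "feasible k B = (\<Inter>N. closure (cocc_vec k ` {\<sigma> \<in> Av B. N \<le> length \<sigma>}))"
    by (intro set_eqI) (simp only: feasible_iff_tendsto[OF assms] sequence_tendsto_iff_closures)
  then show ?thesis
    by (simp add: closed_INT)
qed

section \<open>Feasible vectors are circulations\<close>

lemma sum_cocc_eq_card_windows:
  assumes "\<sigma> \<in> Av_n n B" "k \<ge> 1"
  shows "(\<Sum>\<pi> | \<pi> \<in> Av_n k B \<and> Q \<pi>. cocc \<pi> \<sigma>) = card {i. i < Suc n - k \<and> Q (window k i \<sigma>)}"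
proof -
  let ?\<Pi> = "{\<pi> \<in> Av_n k B. Q \<pi>}"
  have "window_positions \<pi> \<sigma> = {i. i < Suc n - k \<and> window k i \<sigma> = \<pi>}" and "\<pi> \<noteq> []"
    if "\<pi> \<in> ?\<Pi>" for \<pi>
    using that length_Av_n[OF assms(1)] length_Av_n[of \<pi> k B] assms(2)
    by (auto simp: window_positions_def)
  then have "(\<Sum>\<pi>\<in>?\<Pi>. cocc \<pi> \<sigma>) = (\<Sum>\<pi>\<in>?\<Pi>. card {i. i < Suc n - k \<and> window k i \<sigma> = \<pi>})"
    by (intro sum.cong) (auto simp: cocc_eq_card_window_positions)
  also have "\<dots> = card (\<Union>\<pi>\<in>?\<Pi>. {i. i < Suc n - k \<and> window k i \<sigma> = \<pi>})"
    using finite_Av_n[of k B] by (intro card_UN_disjoint[symmetric]) auto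
  also have "(\<Union>\<pi>\<in>?\<Pi>. {i. i < Suc n - k \<and> window k i \<sigma> = \<pi>}) = {i. i < Suc n - k \<and> Q (window k i \<sigma>)}"
    using window_in_Av_n[OF assms(1), of _ k] by auto
  finally show ?thesis .
qed

lemma sum_cocc_total:
  assumes "\<sigma> \<in> Av_n n B" "k \<ge> 1"
  shows "(\<Sum>\<pi>\<in>Av_n k B. cocc \<pi> \<sigma>) = Suc n - k"
  using sum_cocc_eq_card_windows[OF assms, of "\<lambda>_. True"] by (simp flip: lessThan_def)

lemma card_shifted_diff:
  "int (card {i. i < n \<and> P i}) - int (card {i. i < n \<and> P (Suc i)}) = of_bool (P 0) - of_bool (P n)"
proof -
  have "(\<Sum>i<n. of_bool (Q i)) = int (card {i. i < n \<and> Q i})" for Q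
    by (simp add: sum_of_bool_eq lessThan_def Collect_conj_eq)
  then show ?thesis
    using sum_lessThan_telescope'[of "\<lambda>i. of_bool (P i) :: int" n] by (simp add: sum_subtractf)
qed

lemma abs_diff_sum_cocc_overlap_ends_le:
  assumes "\<sigma> \<in> Av_n n B" "k \<ge> 1"
  shows "\<bar>(\<Sum>\<pi> | \<pi> \<in> Av_n k B \<and> overlap_start k \<pi> = x. int (cocc \<pi> \<sigma>))
    - (\<Sum>\<pi> | \<pi> \<in> Av_n k B \<and> overlap_end k \<pi> = x. int (cocc \<pi> \<sigma>))\<bar> \<le> 1"
proof -
  have "i + k \<le> length \<sigma>" if "i < Suc n - k" for i
    using that length_Av_n[OF assms(1)] by simp
  then have
    "{i. i < Suc n - k \<and> overlap_start k (window k i \<sigma>) = x}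
      = {i. i < Suc n - k \<and> window (k - 1) i \<sigma> = x}"
    "{i. i < Suc n - k \<and> overlap_end k (window k i \<sigma>) = x}
      = {i. i < Suc n - k \<and> window (k - 1) (Suc i) \<sigma> = x}"
    using overlap_ends_window[of _ k \<sigma>] assms(2) by auto
  then show ?thesis
    using card_shifted_diff[of "Suc n - k" "\<lambda>i. window (k - 1) i \<sigma> = x"]
    by (simp add: sum_cocc_eq_card_windows[OF assms] flip: of_nat_sum)
qed

lemma tendsto_sum_cocc:
  assumes "((\<lambda>m. cocc_vec k (\<sigma> m)) \<longlongrightarrow> v) F" "A \<subseteq> perms k"
  shows "((\<lambda>m. real (\<Sum>\<pi>\<in>A. cocc \<pi> (\<sigma> m)) / length (\<sigma> m)) \<longlongrightarrow> sum v A) F"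
proof -
  have "real (\<Sum>\<pi>\<in>A. cocc \<pi> (\<sigma> m)) / length (\<sigma> m) = (\<Sum>\<pi>\<in>A. cocc_vec k (\<sigma> m) \<pi>)" for m
    using assms(2)
    by (simp add: sum_divide_distrib) (intro sum.cong, auto simp: cocc_vec_def cocc_prop_def)
  then show ?thesis
    using assms(1) by (simp add: tendsto_fun_iff tendsto_sum)
qed

lemma sum_feasible_eq_one:
  assumes "v \<in> feasible k B" "k \<ge> 1"
  shows "sum v (Av_n k B) = 1"
proof -
  obtain \<sigma> where Av: "\<And>m. \<sigma> m \<in> Av B" and len: "filterlim (\<lambda>m. length (\<sigma> m)) at_top sequentially"
    and lim: "(\<lambda>m. cocc_vec k (\<sigma> m)) \<longlonglongrightarrow> v"
    using assms by (auto simp: feasible_iff_tendsto)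
  have "(\<lambda>m. (real (Suc (length (\<sigma> m)) - k) - length (\<sigma> m)) / length (\<sigma> m)) \<longlonglongrightarrow> 0"
    using assms(2) by (intro tendsto_bounded_over_at_top[OF len, where c = k]) linarith
  moreover have "(real (Suc (length (\<sigma> m)) - k) - length (\<sigma> m)) / length (\<sigma> m)
      = real (Suc (length (\<sigma> m)) - k) / length (\<sigma> m) - 1" for m
    using Av[of m] by (simp add: Av_iff diff_divide_distrib)
  ultimately have "(\<lambda>m. real (Suc (length (\<sigma> m)) - k) / length (\<sigma> m)) \<longlonglongrightarrow> 1"
    by (simp add: LIM_zero_iff)
  moreover have "(\<Sum>\<pi>\<in>Av_n k B. cocc \<pi> (\<sigma> m)) = Suc (length (\<sigma> m)) - k" for m
    using Av[of m] assms(2) by (intro sum_cocc_total) (simp_all add: Av_iff)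
  ultimately show ?thesis
    using tendsto_sum_cocc[OF lim Av_n_subset_perms, of B] LIMSEQ_unique by fastforce
qed

lemma feasible_eq_zero_outside_Av_n:
  assumes "v \<in> feasible k B" "k \<ge> 1" "\<pi> \<notin> Av_n k B"
  shows "v \<pi> = 0"
proof -
  obtain \<sigma> where Av: "\<And>m. \<sigma> m \<in> Av B" and lim: "(\<lambda>m. cocc_vec k (\<sigma> m)) \<longlonglongrightarrow> v"
    using assms by (auto simp: feasible_iff_tendsto)
  have windows: "window k i (\<sigma> m) \<noteq> \<pi>" if "i + k \<le> length (\<sigma> m)" for m i
    using Av[of m] that window_in_Av_n assms(3) unfolding Av_iff by blast
  have "cocc \<pi> (\<sigma> m) = 0" if "\<pi> \<in> perms k" for m
  proof -
    have "\<pi> \<noteq> []" "length \<pi> = k"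
      using that Nil_notin_perms[OF assms(2)] by (auto simp: perms_def)
    moreover from this have "window_positions \<pi> (\<sigma> m) = {}"
      using windows by (auto simp: window_positions_def)
    ultimately show ?thesis
      by (simp add: cocc_eq_card_window_positions)
  qed
  then have "(\<lambda>m. cocc_vec k (\<sigma> m) \<pi>) = (\<lambda>m. 0)"
    by (auto simp: cocc_vec_def cocc_prop_def)
  moreover have "(\<lambda>m. cocc_vec k (\<sigma> m) \<pi>) \<longlonglongrightarrow> v \<pi>"
    using lim by (simp add: tendsto_fun_iff)
  ultimately show ?thesis
    by (simp add: LIMSEQ_const_iff)
qed

lemma circulation_feasible:
  assumes "v \<in> feasible k B" "k \<ge> 1"
  shows "circulation (Av_n k B) (overlap_start k) (overlap_end k) v"
proof -
  obtain \<sigma> where Av: "\<And>m. \<sigma> m \<in> Av B" and len: "filterlim (\<lambda>m. length (\<sigma> m)) at_top sequentially"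
    and lim: "(\<lambda>m. cocc_vec k (\<sigma> m)) \<longlonglongrightarrow> v"
    using assms by (auto simp: feasible_iff_tendsto)
  have "sum v {\<pi> \<in> Av_n k B. overlap_start k \<pi> = x} = sum v {\<pi> \<in> Av_n k B. overlap_end k \<pi> = x}"
    (is "sum v ?out = sum v ?inc") for x
  proof -
    have subset: "?out \<subseteq> perms k" "?inc \<subseteq> perms k"
      using Av_n_subset_perms by blast+
    let ?count = "\<lambda>A m. real (\<Sum>\<pi>\<in>A. cocc \<pi> (\<sigma> m))"
    have "\<bar>?count ?out m - ?count ?inc m\<bar> \<le> 1" for m
      using abs_diff_sum_cocc_overlap_ends_le[of "\<sigma> m" "length (\<sigma> m)" B k x] Av[of m] assms(2)
      unfolding Av_iff by (simp flip: of_nat_sum)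
    then have "(\<lambda>m. (?count ?out m - ?count ?inc m) / length (\<sigma> m)) \<longlonglongrightarrow> 0"
      by (rule tendsto_bounded_over_at_top[OF len])
    moreover have "(\<lambda>m. (?count ?out m - ?count ?inc m) / length (\<sigma> m)) \<longlonglongrightarrow> sum v ?out - sum v ?inc"
      unfolding diff_divide_distrib using subset by (intro tendsto_diff tendsto_sum_cocc[OF lim])
    ultimately show ?thesis
      using LIMSEQ_unique by fastforce
  qed
  then show ?thesis
    using feasible_eq_zero_outside_Av_n[OF assms] by (auto simp: circulation_def)
qed

lemma feasible_subset_overlap_polytope:
  assumes "k \<ge> 1"
  shows "feasible k B \<subseteq> overlap_polytope k B"
proof
  fix v assume v: "v \<in> feasible k B"
  then have "0 \<le> v \<pi>" for \<pi>
    by (cases "\<pi> \<in> perms k") (auto simp: feasible_def cube_def)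
  then show "v \<in> overlap_polytope k B"
    unfolding overlap_polytope_def
    using finite_Av_n circulation_feasible[OF v assms] sum_feasible_eq_one[OF v assms]
    by (intro unit_circulation_in_cycle_polytope)
qed

section \<open>Walks in the overlap graph come from permutations\<close>

lemma exists_between_finite_avoiding:
  fixes L U X :: "'a::unbounded_dense_linorder set"
  assumes fin: "finite L" "finite U" "finite X" and less: "\<And>l u. l \<in> L \<Longrightarrow> u \<in> U \<Longrightarrow> l < u"
  obtains y where "\<And>l. l \<in> L \<Longrightarrow> l < y" "\<And>u. u \<in> U \<Longrightarrow> y < u" "y \<notin> X"
proof -
  obtain b where b: "\<And>l. l \<in> L \<Longrightarrow> l < b" "\<And>u. u \<in> U \<Longrightarrow> b \<le> u"
  proof (cases "U = {}")
    case True
    obtain b where "\<forall>l\<in>L. l < b"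
      using gt_ex[of "Max L"] fin(1) by (cases "L = {}") auto
    then show ?thesis
      using True by (intro that[of b]) auto
  next
    case False
    then show ?thesis
      using fin(2) less by (intro that[of "Min U"]) auto
  qed
  obtain a where a: "\<And>l. l \<in> L \<Longrightarrow> l \<le> a" "a < b"
  proof (cases "L = {}")
    case True
    then show ?thesis
      using lt_ex[of b] that by auto
  next
    case False
    then show ?thesis
      using fin(1) b(1) by (intro that[of "Max L"]) auto
  qed
  obtain y where "y \<in> {a<..<b}" "y \<notin> X"
    using infinite_Ioo[OF a(2)] fin(3) finite_subset[of "{a<..<b}" X] by blast
  with a(1) b(2) show ?thesis
    by (intro that[of y]) force+
qed

lemma extend_to_pattern:
  fixes w :: "'a::unbounded_dense_linorder list"
  assumes "distinct w" "finite X" "set w \<subseteq> X" and \<pi>: "\<pi> \<in> perms (Suc (length w))"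
    and w: "std w = std (take (length w) \<pi>)"
  obtains y where "y \<notin> X" "std (w @ [y]) = \<pi>"
proof -
  let ?n = "length w"
  let ?below = "{i. i < ?n \<and> \<pi> ! i < \<pi> ! ?n}" and ?above = "{i. i < ?n \<and> \<pi> ! ?n < \<pi> ! i}"
  have len: "length \<pi> = Suc ?n" and dist: "distinct \<pi>"
    using \<pi> by (auto simp: perms_def)
  have less: "w ! i < w ! j \<longleftrightarrow> \<pi> ! i < \<pi> ! j" if "i < ?n" "j < ?n" for i j
    using std_nth_less_iff[of i w j] std_nth_less_iff[of i "take ?n \<pi>" j] that len w by simp
  obtain y where y: "\<And>l. l \<in> (!) w ` ?below \<Longrightarrow> l < y" "\<And>u. u \<in> (!) w ` ?above \<Longrightarrow> y < u" "y \<notin> X"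
  proof (rule exists_between_finite_avoiding[of "(!) w ` ?below" "(!) w ` ?above" X])
    show "l < u" if "l \<in> (!) w ` ?below" "u \<in> (!) w ` ?above" for l u
      using that less by fastforce
  qed (use assms(2) in auto)
  have "\<pi> ! i \<noteq> \<pi> ! ?n" if "i < ?n" for i
    using dist len that by (simp add: nth_eq_iff_index_eq)
  then have less_y: "w ! i < y \<longleftrightarrow> \<pi> ! i < \<pi> ! ?n" "y < w ! i \<longleftrightarrow> \<pi> ! ?n < \<pi> ! i" if "i < ?n" for i
    using y(1)[of "w ! i"] y(2)[of "w ! i"] that
    by (metis (mono_tags, lifting) image_eqI mem_Collect_eq linorder_neqE_nat order_less_asym)+
  have "std (w @ [y]) = std \<pi>"
  proof (rule std_eqI)
    show "distinct (w @ [y])" using assms y(3) by auto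
    fix i j assume "i < length (w @ [y])" "j < length (w @ [y])"
    then consider "i < ?n" "j < ?n" | "i < ?n" "j = ?n" | "i = ?n" "j < ?n" | "i = ?n" "j = ?n"
      by fastforce
    then show "(w @ [y]) ! i \<le> (w @ [y]) ! j \<longleftrightarrow> \<pi> ! i \<le> \<pi> ! j"
      using less[of j i] less_y[of i] less_y[of j]
      by cases (auto simp: nth_append linorder_not_less[symmetric])
  qed (use dist len in auto)
  then show ?thesis
    using that[OF y(3)] std_perms[OF \<pi>] by simp
qed

lemma append_window:
  fixes xs :: "'a::unbounded_dense_linorder list"
  assumes "distinct xs" "Suc (length xs) = Suc n + k" "k \<ge> 1" "\<pi> \<in> perms k"
    and overlap: "overlap_end k (window k n xs) = overlap_start k \<pi>"
  obtains y where "y \<notin> set xs" "window k (Suc n) (xs @ [y]) = \<pi>"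
proof -
  let ?w = "drop (Suc n) xs"
  have len_w: "Suc (length ?w) = k"
    using assms(2,3) by simp
  have "window (k - 1) (Suc n) xs = window (k - 1) 0 \<pi>"
    using overlap overlap_ends_window(2)[of n k xs] overlap_ends(1)[of \<pi> k] assms(2-4)
    by (simp add: perms_def)
  then have "std ?w = std (take (length ?w) \<pi>)"
    using len_w by (simp add: window_def flip: len_w)
  then obtain y where "y \<notin> set xs" "std (?w @ [y]) = \<pi>"
    using extend_to_pattern[of ?w "set xs" \<pi>] assms(1,4) len_w set_drop_subset[of "Suc n" xs]
    by (auto simp: distinct_drop)
  moreover have "take k (drop (Suc n) (xs @ [y])) = ?w @ [y]"
    using assms(2) len_w by simp
  ultimately show ?thesis
    by (intro that[of y]) (simp_all add: window_def)
qed

lemma walk_eq_windows: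
  assumes "k \<ge> 1" "es \<noteq> []" "walk (perms k) (overlap_start k) (overlap_end k) es"
  shows "\<exists>xs :: real list. distinct xs \<and> Suc (length xs) = length es + k
    \<and> (\<forall>i<length es. window k i xs = es ! i)"
  using assms(2,3)
proof (induction es rule: rev_nonempty_induct)
  case (single \<pi>)
  then have \<pi>: "\<pi> \<in> perms k" by (simp add: walk_def)
  have "std (map real \<pi>) = \<pi>"
    using std_perms[OF \<pi>] by (subst std_map) (simp_all add: strict_mono_on_def)
  then have "window k 0 (map real \<pi>) = \<pi>"
    using \<pi> by (simp add: window_def perms_def)
  then show ?case
    using \<pi> by (intro exI[of _ "map real \<pi>"]) (simp add: perms_def distinct_map)
next
  case (snoc \<pi> es)
  have \<pi>: "\<pi> \<in> perms k" and walk: "walk (perms k) (overlap_start k) (overlap_end k) es"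
    and overlap: "overlap_end k (last es) = overlap_start k \<pi>"
    using snoc.prems snoc.hyps by (auto simp: walk_append) (simp add: walk_def)
  obtain xs :: "real list" where xs: "distinct xs" "Suc (length xs) = length es + k"
    and windows: "\<And>i. i < length es \<Longrightarrow> window k i xs = es ! i"
    using snoc.IH[OF walk] by blast
  obtain n where n: "length es = Suc n"
    using snoc.hyps by (cases es) auto
  have "window k n xs = last es"
    using windows[of n] n snoc.hyps by (simp add: last_conv_nth)
  then obtain y where y: "y \<notin> set xs" "window k (Suc n) (xs @ [y]) = \<pi>"
    using append_window[of xs n k \<pi>] xs overlap \<pi> assms(1) n by auto
  have "window k i (xs @ [y]) = (es @ [\<pi>]) ! i" if "i < length (es @ [\<pi>])" for i
  proof (cases "i < length es")
    case True
    then show ?thesis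
      using windows[OF True] window_append[of i k xs "[y]"] xs(2) by (simp add: nth_append)
  next
    case False
    then have "i = Suc n"
      using that n by simp
    then show ?thesis
      using y(2) n by (simp add: nth_append)
  qed
  then show ?case
    using xs y by (intro exI[of _ "xs @ [y]"]) auto
qed

lemma walk_realizable:
  assumes "k \<ge> 1" "es \<noteq> []" "walk (perms k) (overlap_start k) (overlap_end k) es"
  shows "\<exists>\<sigma>\<in>perms (length es + k - 1). \<forall>\<pi>\<in>perms k. cocc \<pi> \<sigma> = count_list es \<pi>"
proof -
  obtain xs :: "real list" where xs: "distinct xs" "Suc (length xs) = length es + k"
    "\<And>i. i < length es \<Longrightarrow> window k i xs = es ! i"
    using walk_eq_windows[OF assms] by blast
  have "cocc \<pi> (std xs) = count_list es \<pi>" if "\<pi> \<in> perms k" for \<pi>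
  proof -
    have "length \<pi> = k" "\<pi> \<noteq> []"
      using that assms(1) by (auto simp: perms_def)
    moreover have "i + k \<le> length xs \<longleftrightarrow> i < length es" for i
      using xs(2) by linarith
    ultimately have "window_positions \<pi> (std xs) = {i. i < length es \<and> \<pi> = es ! i}"
      using xs(3) by (auto simp: window_positions_def window_std)
    then show ?thesis
      using \<open>\<pi> \<noteq> []\<close>
      by (simp add: cocc_eq_card_window_positions count_list_eq_length_filter
          length_filter_conv_card)
  qed
  moreover have "std xs \<in> perms (length es + k - 1)"
    using std_in_perms[OF xs(1)] xs(2) by (simp flip: xs(2))
  ultimately show ?thesis by blast
qed

lemma cycle_vec_feasible:
  assumes "k \<ge> 1" and C: "cycle (perms k) (overlap_start k) (overlap_end k) C"
  shows "cycle_vec C \<in> feasible k {}"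
proof -
  let ?es = "\<lambda>m. concat (replicate (Suc m) C)"
  have C_ne: "C \<noteq> []" and C_sub: "set C \<subseteq> perms k"
    using C by (auto simp: cycle_def walk_def)
  have length_es: "length (?es m) = Suc m * length C" for m
    by (simp add: length_concat sum_list_replicate)
  have "\<exists>\<sigma>\<in>perms (length (?es m) + k - 1). \<forall>\<pi>\<in>perms k. cocc \<pi> \<sigma> = count_list (?es m) \<pi>" for m
    using C_ne by (intro walk_realizable assms(1) walk_concat_replicate[OF C]) simp
  then obtain \<sigma> where \<sigma>: "\<And>m. \<sigma> m \<in> perms (length (?es m) + k - 1)"
    and cocc: "\<And>m \<pi>. \<pi> \<in> perms k \<Longrightarrow> cocc \<pi> (\<sigma> m) = count_list (?es m) \<pi>"
    by metis
  have len: "length (\<sigma> m) = Suc m * length C + (k - 1)" for m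
    using \<sigma>[of m] assms(1) unfolding length_es by (simp add: perms_def)
  have scale: "m < Suc m * length C" for m
    using C_ne by (intro less_Suc_mult) simp
  show ?thesis
  proof (rule feasible_if_scaled_tendsto[where \<sigma> = \<sigma> and d = "\<lambda>m. Suc m * length C"])
    show "\<sigma> m \<in> Av {}" for m
      using \<sigma>[of m] len[of m] scale[of m] by (auto simp: Av_empty_iff perms_def simp del: mult_Suc)
    have "length (\<sigma> m) / real (Suc m * length C) = 1 + real (k - 1) / real (Suc m * length C)" for m
      using C_ne by (simp add: len add_divide_distrib del: mult_Suc)
    moreover have "filterlim (\<lambda>m. Suc m * length C) at_top sequentially"
      by (rule filterlim_at_top_mono[OF filterlim_ident])
        (simp add: scale less_imp_le del: mult_Suc)
    then have "(\<lambda>m. real (k - 1) / real (Suc m * length C)) \<longlonglongrightarrow> 0"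
      by (rule tendsto_bounded_over_at_top[where c = "k - 1"]) simp
    then have "(\<lambda>m. 1 + real (k - 1) / real (Suc m * length C)) \<longlonglongrightarrow> 1 + 0"
      by (intro tendsto_add tendsto_const)
    ultimately show "(\<lambda>m. length (\<sigma> m) / real (Suc m * length C)) \<longlonglongrightarrow> 1"
      by simp
    show "(\<lambda>m. cocc \<pi> (\<sigma> m) / real (Suc m * length C)) \<longlonglongrightarrow> cycle_vec C \<pi>" if "\<pi> \<in> perms k" for \<pi>
      unfolding cocc[OF that] count_list_concat_replicate of_nat_mult
      by (simp add: cycle_vec_def del: of_nat_Suc)
    show "cycle_vec C \<pi> = 0" if "\<pi> \<notin> perms k" for \<pi>
      using that C_sub by (auto simp: cycle_vec_def count_list_0_iff)
  qed (use assms(1) scale in simp_all)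
qed

section \<open>Sums of permutations and convexity\<close>

definition shift_append :: "nat \<Rightarrow> nat \<Rightarrow> nat list \<Rightarrow> nat list \<Rightarrow> nat list" where
  "shift_append a b \<sigma> \<rho> = map (\<lambda>x. x + a) \<sigma> @ map (\<lambda>x. x + b) \<rho>"

lemma dsum_eq_shift_append: "dsum \<sigma> \<rho> = shift_append 0 (length \<sigma>) \<sigma> \<rho>"
  by (simp add: dsum_def shift_append_def)

lemma ssum_eq_shift_append: "ssum \<sigma> \<rho> = shift_append (length \<rho>) 0 \<sigma> \<rho>"
  by (simp add: ssum_def shift_append_def)

lemma length_shift_append [simp]: "length (shift_append a b \<sigma> \<rho>) = length \<sigma> + length \<rho>"
  by (simp add: shift_append_def)

lemma window_shift_append:
  shows "i + k \<le> length \<sigma> \<Longrightarrow> window k i (shift_append a b \<sigma> \<rho>) = window k i \<sigma>"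
    and "window k (length \<sigma> + i) (shift_append a b \<sigma> \<rho>) = window k i \<rho>"
  by (simp_all add: shift_append_def window_def take_map drop_map)

lemma window_positions_shift_append:
  fixes a b :: nat and \<pi> \<sigma> \<rho> :: "nat list"
  defines "unbroken \<equiv> window_positions \<pi> \<sigma> \<union> (+) (length \<sigma>) ` window_positions \<pi> \<rho>"
  shows "unbroken \<subseteq> window_positions \<pi> (shift_append a b \<sigma> \<rho>)"
    and "window_positions \<pi> (shift_append a b \<sigma> \<rho>) \<subseteq> unbroken \<union> {length \<sigma> - length \<pi>..<length \<sigma>}"
proof -
  show "unbroken \<subseteq> window_positions \<pi> (shift_append a b \<sigma> \<rho>)"
    by (auto simp: unbroken_def window_positions_def window_shift_append)
  show "window_positions \<pi> (shift_append a b \<sigma> \<rho>) \<subseteq> unbroken \<union> {length \<sigma> - length \<pi>..<length \<sigma>}"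
  proof
    fix i assume i: "i \<in> window_positions \<pi> (shift_append a b \<sigma> \<rho>)"
    consider (left) "i + length \<pi> \<le> length \<sigma>" | (seam) "i \<in> {length \<sigma> - length \<pi>..<length \<sigma>}"
      | (right) j where "i = length \<sigma> + j"
      using le_Suc_ex[of "length \<sigma>" i] by fastforce
    then show "i \<in> unbroken \<union> {length \<sigma> - length \<pi>..<length \<sigma>}"
    proof cases
      case left
      then show ?thesis
        using i by (simp add: unbroken_def window_positions_def window_shift_append(1))
    next
      case right
      then show ?thesis
        using i by (simp add: unbroken_def window_positions_def window_shift_append(2))
    qed simp
  qed
qed

lemma cocc_shift_append:
  assumes "\<pi> \<noteq> []"
  shows "\<bar>real (cocc \<pi> (shift_append a b \<sigma> \<rho>)) - (cocc \<pi> \<sigma> + cocc \<pi> \<rho>)\<bar> \<le> length \<pi>"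
proof -
  let ?unbroken = "window_positions \<pi> \<sigma> \<union> (+) (length \<sigma>) ` window_positions \<pi> \<rho>"
  let ?all = "window_positions \<pi> (shift_append a b \<sigma> \<rho>)"
  let ?seam = "{length \<sigma> - length \<pi>..<length \<sigma>}"
  have "window_positions \<pi> \<sigma> \<inter> (+) (length \<sigma>) ` window_positions \<pi> \<rho> = {}"
    using assms by (auto simp: window_positions_def)
  then have "card ?unbroken = cocc \<pi> \<sigma> + cocc \<pi> \<rho>"
    using assms by (simp add: card_Un_disjoint card_image cocc_eq_card_window_positions)
  moreover have "card ?unbroken \<le> card ?all"
    by (intro card_mono window_positions_shift_append(1)) simp
  moreover have "card ?all \<le> card (?unbroken \<union> ?seam)"
    by (intro card_mono window_positions_shift_append(2)) simp
  then have "card ?all \<le> card ?unbroken + length \<pi>"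
    using card_Un_le[of ?unbroken ?seam] by simp
  ultimately show ?thesis
    using assms by (simp add: cocc_eq_card_window_positions)
qed

definition sum_closed :: "nat list set \<Rightarrow> bool" where
  "sum_closed B \<longleftrightarrow> (\<forall>\<sigma>\<in>Av B. \<forall>\<rho>\<in>Av B. \<exists>a b. shift_append a b \<sigma> \<rho> \<in> Av B)"

lemma sum_closed_if_closed_dsum_or_ssum: "closed_dsum B \<or> closed_ssum B \<Longrightarrow> sum_closed B"
  unfolding sum_closed_def closed_dsum_def closed_ssum_def dsum_eq_shift_append ssum_eq_shift_append
  by blast

lemma sum_closed_list:
  assumes "sum_closed B" "L \<noteq> []" "set L \<subseteq> Av B"
  shows "\<exists>\<tau>\<in>Av B. length \<tau> = sum_list (map length L) \<and> (\<forall>\<pi>. \<pi> \<noteq> [] \<longrightarrow>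
    \<bar>real (cocc \<pi> \<tau>) - (\<Sum>\<sigma>\<leftarrow>L. real (cocc \<pi> \<sigma>))\<bar> \<le> length \<pi> * length L)"
  using assms(2,3)
proof (induction L rule: list_nonempty_induct)
  case (single \<sigma>)
  then show ?case by auto
next
  case (cons \<sigma> L)
  then obtain \<tau> where \<tau>: "\<tau> \<in> Av B" "length \<tau> = sum_list (map length L)"
    and count: "\<And>\<pi>. \<pi> \<noteq> [] \<Longrightarrow> \<bar>real (cocc \<pi> \<tau>) - (\<Sum>\<sigma>\<leftarrow>L. real (cocc \<pi> \<sigma>))\<bar> \<le> length \<pi> * length L"
    by auto
  obtain a b where "shift_append a b \<sigma> \<tau> \<in> Av B"
    using assms(1) cons.prems \<tau>(1) unfolding sum_closed_def by (meson list.set_intros(1) subsetD)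
  moreover have "\<bar>real (cocc \<pi> (shift_append a b \<sigma> \<tau>)) - (\<Sum>\<rho>\<leftarrow>\<sigma> # L. real (cocc \<pi> \<rho>))\<bar>
      \<le> length \<pi> * length (\<sigma> # L)" if "\<pi> \<noteq> []" for \<pi>
    using cocc_shift_append[OF that, of a b \<sigma> \<tau>] count[OF that] by simp
  ultimately show ?case
    using \<tau>(2) by (intro bexI[of _ "shift_append a b \<sigma> \<tau>"]) auto
qed

lemma sum_closed_copies:
  assumes "sum_closed B" "\<sigma> \<in> Av B" "\<rho> \<in> Av B" "a + b > 0"
  shows "\<exists>\<tau>\<in>Av B. length \<tau> = a * length \<sigma> + b * length \<rho> \<and> (\<forall>\<pi>. \<pi> \<noteq> [] \<longrightarrow>
    \<bar>real (cocc \<pi> \<tau>) - (a * real (cocc \<pi> \<sigma>) + b * real (cocc \<pi> \<rho>))\<bar> \<le> length \<pi> * (a + b))"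
proof -
  let ?L = "replicate a \<sigma> @ replicate b \<rho>"
  have "?L \<noteq> []" "set ?L \<subseteq> Av B"
    using assms(2-4) by auto
  from sum_closed_list[OF assms(1) this] show ?thesis
    by (simp add: sum_list_replicate)
qed

lemma tendsto_nat_ceiling_over:
  fixes n :: "'a \<Rightarrow> nat" and u :: real
  assumes "filterlim n at_top F" "0 \<le> u"
  shows "((\<lambda>x. nat \<lceil>u * n x\<rceil> / n x) \<longlongrightarrow> u) F"
proof -
  have "\<bar>real (nat \<lceil>u * n x\<rceil>) - u * n x\<bar> \<le> 1" for x
  proof -
    have "real (nat \<lceil>u * n x\<rceil>) = of_int \<lceil>u * n x\<rceil>"
      using assms(2) by simp
    then show ?thesis by linarith
  qed
  then have "((\<lambda>x. (real (nat \<lceil>u * n x\<rceil>) - u * n x) / n x) \<longlongrightarrow> 0) F"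
    by (rule tendsto_bounded_over_at_top[OF assms(1)])
  moreover have "\<forall>\<^sub>F x in F. n x > 0"
    using eventually_compose_filterlim[OF eventually_gt_at_top assms(1)] .
  then have "\<forall>\<^sub>F x in F. (real (nat \<lceil>u * n x\<rceil>) - u * n x) / n x = nat \<lceil>u * n x\<rceil> / n x - u"
    by eventually_elim (simp add: diff_divide_distrib)
  ultimately show ?thesis
    by (simp add: LIM_zero_iff cong: tendsto_cong)
qed

definition weighted_mixture :: "real \<Rightarrow> real \<Rightarrow> real \<Rightarrow> nat list \<Rightarrow> nat list \<Rightarrow> nat list \<Rightarrow> bool" where
  "weighted_mixture d p q \<sigma> \<rho> \<tau> \<longleftrightarrow> length \<tau> / d = p + q \<and> (\<forall>\<pi>. \<pi> \<noteq> [] \<longrightarrow>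
    \<bar>cocc \<pi> \<tau> / d - (p * cocc_prop \<pi> \<sigma> + q * cocc_prop \<pi> \<rho>)\<bar>
      \<le> length \<pi> * (p / length \<sigma> + q / length \<rho>))"

lemma sum_closed_weighted:
  fixes a b N :: nat
  assumes "sum_closed B" "\<sigma> \<in> Av B" "\<rho> \<in> Av B" "a + b > 0" "N > 0"
  defines "p \<equiv> a / real (N * length \<rho>)" and "q \<equiv> b / real (N * length \<sigma>)"
    and "d \<equiv> real (N * length \<sigma> * length \<rho>)"
  shows "\<exists>\<tau>\<in>Av B. weighted_mixture d p q \<sigma> \<rho> \<tau>"
proof -
  obtain \<tau> where \<tau>: "\<tau> \<in> Av B" "length \<tau> = a * length \<sigma> + b * length \<rho>"
    and cocc: "\<And>\<pi>. \<pi> \<noteq> [] \<Longrightarrow>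
      \<bar>real (cocc \<pi> \<tau>) - (a * real (cocc \<pi> \<sigma>) + b * real (cocc \<pi> \<rho>))\<bar> \<le> length \<pi> * (a + b)"
    using sum_closed_copies[OF assms(1-4)] by blast
  have pos: "length \<sigma> > 0" "length \<rho> > 0" "d > 0"
    using assms(2,3,5) by (auto simp: Av_iff d_def)
  have weights: "(a * r + b * s) / d = p * (r / length \<sigma>) + q * (s / length \<rho>)" for r s :: real
    using pos(1,2) by (simp add: p_def q_def d_def add_divide_distrib)
  have "length \<tau> / d = p + q"
    using weights[of "length \<sigma>" "length \<rho>"] pos(1,2) by (simp add: \<tau>(2))
  moreover have "\<bar>cocc \<pi> \<tau> / d - (p * cocc_prop \<pi> \<sigma> + q * cocc_prop \<pi> \<rho>)\<bar>
      \<le> length \<pi> * (p / length \<sigma> + q / length \<rho>)" if "\<pi> \<noteq> []" for \<pi>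
  proof -
    have "cocc \<pi> \<tau> / d - (p * cocc_prop \<pi> \<sigma> + q * cocc_prop \<pi> \<rho>)
        = (cocc \<pi> \<tau> - (a * real (cocc \<pi> \<sigma>) + b * real (cocc \<pi> \<rho>))) / d"
      by (simp add: cocc_prop_def diff_divide_distrib weights)
    also have "\<bar>\<dots>\<bar> \<le> length \<pi> * (a + b) / d"
      using divide_right_mono[OF cocc[OF that], of d] pos(3) by simp
    also have "\<dots> = length \<pi> * ((a + b) / d)"
      by simp
    also have "(a + b) / d = p / length \<sigma> + q / length \<rho>"
      using weights[of 1 1] by simp
    finally show ?thesis .
  qed
  ultimately show ?thesis
    using \<tau>(1) unfolding weighted_mixture_def by blast
qed

lemma sum_closed_sequence:
  fixes u w :: real
  assumes "sum_closed B" "0 \<le> u" "0 \<le> w" "u + w > 0"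
    and \<sigma>: "\<And>m. \<sigma> m \<in> Av B" and \<rho>: "\<And>m. \<rho> m \<in> Av B"
  defines "d \<equiv> \<lambda>m. Suc m * length (\<sigma> m) * length (\<rho> m)"
  obtains \<tau> p q where "\<And>m. \<tau> m \<in> Av B" "\<And>m. weighted_mixture (d m) (p m) (q m) (\<sigma> m) (\<rho> m) (\<tau> m)"
    "p \<longlonglongrightarrow> u" "q \<longlonglongrightarrow> w"
proof -
  have pos: "length (\<sigma> m) > 0" "length (\<rho> m) > 0" for m
    using \<sigma>[of m] \<rho>[of m] by (auto simp: Av_iff)
  \<comment> \<open>With a copies of \<sigma> and b copies of \<rho> the two blocks have total lengths in the ratio u : w up
    to rounding, whatever the lengths of the two summands.\<close>
  define a where "a m = nat \<lceil>u * (Suc m * length (\<rho> m))\<rceil>" for m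
  define b where "b m = nat \<lceil>w * (Suc m * length (\<sigma> m))\<rceil>" for m
  define p where "p m = a m / real (Suc m * length (\<rho> m))" for m
  define q where "q m = b m / real (Suc m * length (\<sigma> m))" for m
  have "a m + b m > 0" for m
    using assms(2-4) pos[of m]
    by (cases "u > 0") (auto simp: a_def b_def simp del: mult_Suc of_nat_Suc)
  then have "\<exists>\<tau>\<in>Av B. weighted_mixture (d m) (p m) (q m) (\<sigma> m) (\<rho> m) \<tau>" for m
    unfolding p_def q_def d_def by (intro sum_closed_weighted assms(1) \<sigma> \<rho>) auto
  then obtain \<tau> where "\<forall>m. \<tau> m \<in> Av B \<and> weighted_mixture (d m) (p m) (q m) (\<sigma> m) (\<rho> m) (\<tau> m)"
    by metis
  moreover have "filterlim (\<lambda>m. Suc m * n m) at_top sequentially"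
    if "\<And>m. 0 < n m" for n :: "nat \<Rightarrow> nat"
    using less_Suc_mult[OF that]
    by (intro filterlim_at_top_mono[OF filterlim_ident] always_eventually allI) (rule less_imp_le)
  then have "p \<longlonglongrightarrow> u" "q \<longlonglongrightarrow> w"
    unfolding p_def q_def a_def b_def using assms(2,3) pos
    by (intro tendsto_nat_ceiling_over; simp)+
  ultimately show ?thesis
    by (intro that[of \<tau> p q]) blast+
qed

lemma tendsto_approx_weighted_sum:
  fixes f g h p q :: "nat \<Rightarrow> real" and m n :: "nat \<Rightarrow> nat"
  assumes "p \<longlonglongrightarrow> u" "q \<longlonglongrightarrow> w" "f \<longlonglongrightarrow> x" "g \<longlonglongrightarrow> y"
    and "filterlim m at_top sequentially" "filterlim n at_top sequentially"
    and error: "\<And>i. \<bar>h i - (p i * f i + q i * g i)\<bar> \<le> c * (p i / m i + q i / n i)"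
  shows "h \<longlonglongrightarrow> u * x + w * y"
proof (rule Lim_transform[where g = "\<lambda>i. p i * f i + q i * g i"])
  note at_infinity =
    filterlim_compose[OF filterlim_real_sequentially, THEN filterlim_at_top_imp_at_infinity]
  have "(\<lambda>i. c * (p i / m i + q i / n i)) \<longlonglongrightarrow> c * (0 + 0)"
    by (intro tendsto_mult_left tendsto_add tendsto_divide_0[OF assms(1) at_infinity[OF assms(5)]]
      tendsto_divide_0[OF assms(2) at_infinity[OF assms(6)]])
  then have "(\<lambda>i. c * (p i / m i + q i / n i)) \<longlonglongrightarrow> 0"
    by simp
  then show "(\<lambda>i. h i - (p i * f i + q i * g i)) \<longlonglongrightarrow> 0"
    by (rule Lim_null_comparison[rotated]) (simp add: error)
  show "(\<lambda>i. p i * f i + q i * g i) \<longlonglongrightarrow> u * x + w * y"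
    by (intro tendsto_add tendsto_mult assms(1-4))
qed

lemma convex_feasible:
  assumes "sum_closed B" "k \<ge> 1"
  shows "convex (feasible k B)"
proof (rule convexI)
  fix x y and u w :: real
  assume xy: "x \<in> feasible k B" "y \<in> feasible k B" and uw: "0 \<le> u" "0 \<le> w" "u + w = 1"
  obtain \<sigma> where \<sigma>: "\<And>m. \<sigma> m \<in> Av B" "filterlim (\<lambda>m. length (\<sigma> m)) at_top sequentially"
    "\<And>\<pi>. \<pi> \<in> perms k \<Longrightarrow> (\<lambda>m. cocc_prop \<pi> (\<sigma> m)) \<longlonglongrightarrow> x \<pi>"
    using xy(1) by (auto simp: feasible_def)
  obtain \<rho> where \<rho>: "\<And>m. \<rho> m \<in> Av B" "filterlim (\<lambda>m. length (\<rho> m)) at_top sequentially"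
    "\<And>\<pi>. \<pi> \<in> perms k \<Longrightarrow> (\<lambda>m. cocc_prop \<pi> (\<rho> m)) \<longlonglongrightarrow> y \<pi>"
    using xy(2) by (auto simp: feasible_def)
  let ?d = "\<lambda>m. Suc m * length (\<sigma> m) * length (\<rho> m)"
  have "u + w > 0"
    using uw(3) by simp
  obtain \<tau> p q where \<tau>: "\<And>m. \<tau> m \<in> Av B"
    and mixture: "\<And>m. weighted_mixture (?d m) (p m) (q m) (\<sigma> m) (\<rho> m) (\<tau> m)"
    and lim: "p \<longlonglongrightarrow> u" "q \<longlonglongrightarrow> w"
    using sum_closed_sequence[where \<sigma> = \<sigma> and \<rho> = \<rho>, OF assms(1) uw(1,2) \<open>u + w > 0\<close> \<sigma>(1) \<rho>(1)]
    by blast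
  have len: "length (\<tau> m) / ?d m = p m + q m" for m
    using mixture[of m] unfolding weighted_mixture_def by blast
  have cocc: "\<bar>cocc \<pi> (\<tau> m) / ?d m - (p m * cocc_prop \<pi> (\<sigma> m) + q m * cocc_prop \<pi> (\<rho> m))\<bar>
      \<le> length \<pi> * (p m / length (\<sigma> m) + q m / length (\<rho> m))" if "\<pi> \<noteq> []" for \<pi> m
    using mixture[of m] that unfolding weighted_mixture_def by blast
  show "u *\<^sub>R x + w *\<^sub>R y \<in> feasible k B"
  proof (rule feasible_if_scaled_tendsto[where \<sigma> = \<tau> and d = ?d])
    show "m < ?d m" for m
      unfolding mult.assoc using \<sigma>(1)[of m] \<rho>(1)[of m] by (intro less_Suc_mult) (simp add: Av_iff)
    show "(\<lambda>m. length (\<tau> m) / ?d m) \<longlonglongrightarrow> 1"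
      unfolding len using tendsto_add[OF lim] uw(3) by simp
    show "(\<lambda>m. cocc \<pi> (\<tau> m) / ?d m) \<longlonglongrightarrow> (u *\<^sub>R x + w *\<^sub>R y) \<pi>" if "\<pi> \<in> perms k" for \<pi>
    proof -
      have "\<pi> \<noteq> []"
        using that Nil_notin_perms[OF assms(2)] by auto
      from tendsto_approx_weighted_sum[OF lim \<sigma>(3)[OF that] \<rho>(3)[OF that] \<sigma>(2) \<rho>(2) cocc[OF this]]
      show ?thesis
        unfolding plus_fun_apply scaleR_fun_apply real_scaleR_def .
    qed
    show "(u *\<^sub>R x + w *\<^sub>R y) \<pi> = 0" if "\<pi> \<notin> perms k" for \<pi>
      using xy that by (simp add: feasible_def cube_def)
  qed (use assms(2) \<tau> in simp_all)
qed

lemma dsum_in_perms: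
  assumes "\<sigma> \<in> perms m" "\<rho> \<in> perms n"
  shows "dsum \<sigma> \<rho> \<in> perms (m + n)"
proof -
  have "(\<lambda>x. x + m) ` {1..n} = {m + 1..m + n}"
    using image_add_atLeastAtMost'[of m 1 n] by (simp add: add.commute)
  then show ?thesis
    using assms by (auto simp: perms_iff dsum_def)
qed

lemma ssum_in_perms:
  assumes "\<sigma> \<in> perms m" "\<rho> \<in> perms n"
  shows "ssum \<sigma> \<rho> \<in> perms (m + n)"
proof -
  have "set (ssum \<sigma> \<rho>) = set (dsum \<rho> \<sigma>)" "length (ssum \<sigma> \<rho>) = length (dsum \<rho> \<sigma>)"
    by (auto simp: ssum_def dsum_def)
  then show ?thesis
    using dsum_in_perms[OF assms(2,1)] by (simp add: perms_iff add.commute)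
qed

lemma sum_closed_empty: "sum_closed {}"
proof -
  have "dsum \<sigma> \<rho> \<in> Av {}" if "\<sigma> \<in> Av {}" "\<rho> \<in> Av {}" for \<sigma> \<rho>
    using that dsum_in_perms[of \<sigma> "length \<sigma>" \<rho> "length \<rho>"] by (auto simp: Av_empty_iff dsum_def)
  then show ?thesis
    unfolding sum_closed_def dsum_eq_shift_append by blast
qed

lemma overlap_polytope_subset_feasible:
  assumes "k \<ge> 1"
  shows "overlap_polytope k B \<subseteq> feasible k {}"
  unfolding overlap_polytope_def cycle_polytope_def
proof (rule hull_minimal)
  show "convex (feasible k {})"
    using sum_closed_empty assms by (rule convex_feasible)
  have "cycle_vec C \<in> feasible k {}"
    if "simple_cycle (Av_n k B) (overlap_start k) (overlap_end k) C" for C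
    using cycle_vec_feasible[OF assms] simple_cycle_mono[OF that Av_n_subset_perms]
    by (simp add: simple_cycle_def)
  then show "{cycle_vec C |C. simple_cycle (Av_n k B) (overlap_start k) (overlap_end k) C}
      \<subseteq> feasible k {}"
    by blast
qed

section \<open>Dimension of the feasible region\<close>

lemma windows_connected:
  assumes "\<sigma> \<in> Av_n n B" "k \<ge> 1" "i < j" "j + (k - 1) \<le> n"
  shows "(window (k - 1) i \<sigma>, window (k - 1) j \<sigma>)
    \<in> ((\<lambda>\<pi>. (overlap_start k \<pi>, overlap_end k \<pi>)) ` Av_n k B)\<^sup>+"
proof -
  have edge: "(window (k - 1) l \<sigma>, window (k - 1) (Suc l) \<sigma>)
      \<in> (\<lambda>\<pi>. (overlap_start k \<pi>, overlap_end k \<pi>)) ` Av_n k B" if "Suc l + (k - 1) \<le> n" for l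
  proof (rule image_eqI)
    have "l + k \<le> n"
      using that assms(2) by simp
    then show "window k l \<sigma> \<in> Av_n k B"
      by (rule window_in_Av_n[OF assms(1)])
    show "(window (k - 1) l \<sigma>, window (k - 1) (Suc l) \<sigma>)
        = (overlap_start k (window k l \<sigma>), overlap_end k (window k l \<sigma>))"
      using overlap_ends_window[of l k \<sigma>] length_Av_n[OF assms(1)] \<open>l + k \<le> n\<close> assms(2) by simp
  qed
  from assms(3,4) show ?thesis
  proof (induction i j rule: less_Suc_induct[case_names step trans])
    case (step i)
    then show ?case
      by (intro r_into_trancl edge)
  next
    case (trans i j l)
    then show ?case
      by (auto intro: trancl_trans)
  qed
qed

lemma strongly_connected_overlap:
  assumes "sum_closed B" "k \<ge> 1" "k = 1 \<longrightarrow> Av_n k B \<noteq> {}"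
  shows "strongly_connected (Av_n (k - 1) B) (Av_n k B) (overlap_start k) (overlap_end k)"
  unfolding strongly_connected_def
proof (intro ballI)
  fix x y assume xy: "x \<in> Av_n (k - 1) B" "y \<in> Av_n (k - 1) B"
  have "\<exists>n. \<exists>\<sigma>\<in>Av_n n B. \<exists>j>0. j + (k - 1) \<le> n \<and> window (k - 1) 0 \<sigma> = x \<and> window (k - 1) j \<sigma> = y"
  proof (cases "k = 1")
    case True
    then obtain \<pi> where "\<pi> \<in> Av_n 1 B"
      using assms(3) by blast
    moreover have "x = []" "y = []"
      using xy True Av_n_zero_subset by auto
    ultimately show ?thesis
      using True by (intro exI[of _ 1] bexI[of _ \<pi>]) (auto simp: window_def std_def)
  next
    case False
    have len: "length x = k - 1" "length y = k - 1"
      using xy by (simp_all add: length_Av_n)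
    then have "x \<in> Av B" "y \<in> Av B"
      using xy False assms(2) by (auto simp: Av_iff)
    then obtain a b where "shift_append a b x y \<in> Av B"
      using assms(1) unfolding sum_closed_def by blast
    then have "shift_append a b x y \<in> Av_n (k - 1 + (k - 1)) B"
      using len by (simp add: Av_iff)
    moreover have "window (k - 1) 0 x = x" "window (k - 1) 0 y = y"
      using xy Av_n_subset_perms window_perms by blast+
    then have "window (k - 1) 0 (shift_append a b x y) = x"
      "window (k - 1) (k - 1) (shift_append a b x y) = y"
      using window_shift_append(1)[of 0 "k - 1" x a b y]
        window_shift_append(2)[of "k - 1" x 0 a b y] len
      by simp_all
    ultimately show ?thesis
      using False assms(2)
      by (intro exI[of _ "k - 1 + (k - 1)"] bexI[of _ "shift_append a b x y"]
          exI[of _ "k - 1"]) auto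
  qed
  then show "(x, y) \<in> ((\<lambda>\<pi>. (overlap_start k \<pi>, overlap_end k \<pi>)) ` Av_n k B)\<^sup>+"
    using windows_connected assms(2) by blast
qed

lemma affine_dim_feasible_le:
  assumes "sum_closed B" "k \<ge> 1"
  shows "affine_dim (feasible k B) \<le> int (card (Av_n k B)) - int (card (Av_n (k - 1) B))"
proof (cases "k = 1 \<and> Av_n k B = {}")
  case True
  then have "feasible k B = {}"
    using sum_feasible_eq_one[of _ k B] assms(2) by fastforce
  moreover have "card (Av_n (k - 1) B) \<le> 1"
    using True card_mono[OF _ Av_n_zero_subset[of B]] by simp
  ultimately show ?thesis
    using True by (simp add: affine_dim_def)
next
  case False
  have "feasible k B
      \<subseteq> {v. circulation (Av_n k B) (overlap_start k) (overlap_end k) v \<and> sum v (Av_n k B) = 1}"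
    using circulation_feasible sum_feasible_eq_one assms(2) by blast
  moreover have "strongly_connected (Av_n (k - 1) B) (Av_n k B) (overlap_start k) (overlap_end k)"
    using strongly_connected_overlap assms False by blast
  moreover have "overlap_end k \<pi> \<in> Av_n (k - 1) B" if "\<pi> \<in> Av_n k B" for \<pi>
    using that assms(2) by (rule overlap_end_in_Av_n)
  ultimately show ?thesis
    by (intro affine_dim_unit_circulations_le finite_Av_n)
qed

section \<open>Classes avoiding one pattern\<close>

lemma subseq_map_add:
  fixes \<sigma> :: "nat list"
  assumes "subseq ys (map (\<lambda>x. x + a) \<sigma>)"
  shows "contains \<sigma> (std ys)" and "set ys \<subseteq> (\<lambda>x. x + a) ` set \<sigma>"
proof -
  obtain N where N: "ys = map (\<lambda>x. x + a) (nths \<sigma> N)"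
    using assms by (auto simp: subseq_conv_nths nths_map)
  then show "contains \<sigma> (std ys)"
    unfolding contains_iff_subseq by (metis std_map_add subseq_conv_nths)
  show "set ys \<subseteq> (\<lambda>x. x + a) ` set \<sigma>"
    using N set_nths_subset[of \<sigma> N] by auto
qed

lemma hd_last_std:
  assumes "ys \<noteq> []"
  shows "hd (std ys) < last (std ys) \<longleftrightarrow> hd ys < last ys"
    and "last (std ys) < hd (std ys) \<longleftrightarrow> last ys < hd ys"
proof -
  have "std ys \<noteq> []"
    using assms by (simp flip: length_greater_0_conv)
  then show "hd (std ys) < last (std ys) \<longleftrightarrow> hd ys < last ys"
    and "last (std ys) < hd (std ys) \<longleftrightarrow> last ys < hd ys"
    using assms std_nth_less_iff[of 0 ys "length ys - 1"] std_nth_less_iff[of "length ys - 1" ys 0]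
    by (simp_all add: hd_conv_nth last_conv_nth)
qed

lemma occurrence_across_seam:
  assumes "contains (shift_append a b \<sigma> \<rho>) \<tau>" "\<not> contains \<sigma> \<tau>" "\<not> contains \<rho> \<tau>"
  obtains x y where "x \<in> set \<sigma>" "y \<in> set \<rho>"
    "hd \<tau> < last \<tau> \<longleftrightarrow> x + a < y + b" "last \<tau> < hd \<tau> \<longleftrightarrow> y + b < x + a"
proof -
  obtain ys where ys: "subseq ys (map (\<lambda>x. x + a) \<sigma> @ map (\<lambda>x. x + b) \<rho>)" "std ys = \<tau>"
    using assms(1) unfolding contains_iff_subseq shift_append_def by blast
  obtain left right where split: "ys = left @ right"
    "subseq left (map (\<lambda>x. x + a) \<sigma>)" "subseq right (map (\<lambda>x. x + b) \<rho>)"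
    using ys(1) by (rule subseq_appendE)
  have "left \<noteq> []" "right \<noteq> []"
    using subseq_map_add(1)[OF split(2)] subseq_map_add(1)[OF split(3)]
      assms(2,3) ys(2) split(1) by auto
  then have "hd ys \<in> set left" "last ys \<in> set right" "ys \<noteq> []"
    using split(1) by auto
  then obtain x y where "x \<in> set \<sigma>" "hd ys = x + a" "y \<in> set \<rho>" "last ys = y + b"
    using subseq_map_add(2)[OF split(2)] subseq_map_add(2)[OF split(3)] by blast
  then show ?thesis
    using hd_last_std[OF \<open>ys \<noteq> []\<close>] ys(2) by (intro that[of x y]) simp_all
qed

lemma dsum_in_Av_singleton:
  assumes "\<sigma> \<in> Av {\<tau>}" "\<rho> \<in> Av {\<tau>}" "\<not> hd \<tau> < last \<tau>"
  shows "dsum \<sigma> \<rho> \<in> Av {\<tau>}"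
proof -
  have \<sigma>: "\<sigma> \<noteq> []" "\<sigma> \<in> perms (length \<sigma>)" "\<not> contains \<sigma> \<tau>"
    and \<rho>: "\<rho> \<in> perms (length \<rho>)" "\<not> contains \<rho> \<tau>"
    using assms(1,2) by (simp_all add: Av_singleton_iff)
  have "\<not> contains (shift_append 0 (length \<sigma>) \<sigma> \<rho>) \<tau>"
    using \<sigma> \<rho> assms(3) by (auto simp: perms_iff elim!: occurrence_across_seam)
  then show ?thesis
    using \<sigma> dsum_in_perms[OF \<sigma>(2) \<rho>(1)]
    by (simp add: Av_singleton_iff dsum_eq_shift_append) (simp add: shift_append_def)
qed

lemma ssum_in_Av_singleton:
  assumes "\<sigma> \<in> Av {\<tau>}" "\<rho> \<in> Av {\<tau>}" "\<not> last \<tau> < hd \<tau>"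
  shows "ssum \<sigma> \<rho> \<in> Av {\<tau>}"
proof -
  have \<sigma>: "\<sigma> \<noteq> []" "\<sigma> \<in> perms (length \<sigma>)" "\<not> contains \<sigma> \<tau>"
    and \<rho>: "\<rho> \<in> perms (length \<rho>)" "\<not> contains \<rho> \<tau>"
    using assms(1,2) by (simp_all add: Av_singleton_iff)
  have "\<not> contains (shift_append (length \<rho>) 0 \<sigma> \<rho>) \<tau>"
    using \<sigma> \<rho> assms(3) by (auto simp: perms_iff elim!: occurrence_across_seam)
  then show ?thesis
    using \<sigma> ssum_in_perms[OF \<sigma>(2) \<rho>(1)]
    by (simp add: Av_singleton_iff ssum_eq_shift_append) (simp add: shift_append_def)
qed

lemma sum_closed_singleton: "sum_closed {\<tau>}"
  unfolding sum_closed_def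
proof (intro ballI)
  fix \<sigma> \<rho> assume "\<sigma> \<in> Av {\<tau>}" "\<rho> \<in> Av {\<tau>}"
  then have "dsum \<sigma> \<rho> \<in> Av {\<tau>} \<or> ssum \<sigma> \<rho> \<in> Av {\<tau>}"
    using dsum_in_Av_singleton ssum_in_Av_singleton by (cases "hd \<tau> < last \<tau>") auto
  then show "\<exists>a b. shift_append a b \<sigma> \<rho> \<in> Av {\<tau>}"
    unfolding dsum_eq_shift_append ssum_eq_shift_append by blast
qed

theorem mainTheorem1:
  fixes k :: nat and B :: "nat list set"
  assumes "k \<ge> 1" and "B \<subseteq> all_perms"
  shows "closed (feasible k B) \<and> feasible k B \<subseteq> cube k
    \<and> feasible k B \<subseteq> overlap_polytope k B
    \<and> overlap_polytope k B \<subseteq> feasible k {}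
    \<and> ((closed_dsum B \<or> closed_ssum B) \<longrightarrow>
          convex (feasible k B)
          \<and> affine_dim (feasible k B) \<le> int (card (Av_n k B)) - int (card (Av_n (k - 1) B)))
    \<and> (\<forall>\<tau>\<in>all_perms. convex (feasible k {\<tau>}))"
proof (intro conjI impI ballI)
  show "closed (feasible k B)"
    using assms(1) by (rule closed_feasible)
  show "feasible k B \<subseteq> cube k"
    by (auto simp: feasible_def)
  show "feasible k B \<subseteq> overlap_polytope k B"
    using assms(1) by (rule feasible_subset_overlap_polytope)
  show "overlap_polytope k B \<subseteq> feasible k {}"
    using assms(1) by (rule overlap_polytope_subset_feasible)
  show "convex (feasible k {\<tau>})" for \<tau>
    using sum_closed_singleton assms(1) by (rule convex_feasible)
next
  assume "closed_dsum B \<or> closed_ssum B"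
  then have "sum_closed B"
    by (rule sum_closed_if_closed_dsum_or_ssum)
  then show "convex (feasible k B)"
    and "affine_dim (feasible k B) \<le> int (card (Av_n k B)) - int (card (Av_n (k - 1) B))"
    using assms(1) by (rule convex_feasible, rule affine_dim_feasible_le)
qed

end
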